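(* Let $R$ be a graded local ring and let $D=\bigoplus_{i\ge 0}F_i$ be an anchored free flag over $R$ with differential $d$ and structure maps $A_{i,j}\colon F_i\to F_j$ ($j<i$), so that $A_{i,i-1}=\delta_i$, where $F_0\xleftarrow{\delta_1}F_1\xleftarrow{\delta_2}F_2\leftarrow\cdots$ is a minimal free resolution of $H(D)$. Assume that $H(D)$ is a complete intersection, and let $\operatorname{Fold}(F_\bullet)$ be the minimal free resolution $(F_\bullet,\delta)$ of $H(D)$ considered as a differential module. Then $D\cong \operatorname{Fold}(F_\bullet)$ as differential modules if and only if $\operatorname{im}A_{i,0}\subseteq \operatorname{im}(\delta_1\colon F_1\to F_0)$ for all $i\ge 2$.
   Context: Graded local ring: a commutative Noetherian ring that is either local, or graded with a unique homogeneous maximal ideal (e.g. a positively graded polynomial ring over a field), so that minimal free resolutions make sense. A differential module $(D,d)$ over $R$ is an $R$-module $D$ with an $R$-endomorphism $d$ with $d^2=0$; its homology is $H(D)=\ker d/\operatorname{im}d$. A morphism of differential modules is an $R$-linear map commuting with the differentials; an isomorphism is a bijective morphism. The fold of a complex $(F_\bullet,\delta)$ is the differential module $\operatorname{Fold}(F_\bullet)=(\bigoplus_i F_i,\bigoplus_i\delta_i)$. A free flag is a differential module $D$ with a splitting $D=\bigoplus_{i\ge0}F_i$ into free $R$-modules such that $d(F_i)\subseteq\bigoplus_{j<i}F_j$ for all $i$. Its structure maps $A_{i,j}\colon F_i\to F_j$ ($j<i$) are the components of $d|_{F_i}$. A free flag is anchored if there is a minimal free resolution $(F_\bullet,\delta)\to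 H(D)$ with the same modules $F_i$ and $A_{i,i-1}=\delta_i$ for all $i$. "$H(D)$ is a complete intersection" means $H(D)\cong R/\mathfrak a$ with $\mathfrak a$ an ideal generated by a regular sequence (so $F_\bullet$ is a Koszul complex). *)

theory Defs
  imports "HOL-Library.Set_Algebras" "HOL.Modules"
begin

text \<open>
  The base ring is a type of class \<open>comm_ring_1\<close>, and an ambient module is a type of class
  \<open>ab_group_add\<close> together with a scalar multiplication satisfying the locale \<^locale>\<open>module\<close>.
  An ideal is a submodule of the ring acting on itself, so ideals and generated ideals are
  \<open>module.subspace times\<close> and \<open>module.span times\<close>.
\<close>

section \<open>Internal direct sums\<close>

definition decomposes :: "('i \<Rightarrow> 'a::ab_group_add set) \<Rightarrow> 'a \<Rightarrow> ('i \<Rightarrow> 'a) \<Rightarrow> bool" where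
  "decomposes F x c \<longleftrightarrow>
     (\<forall>i. c i \<in> F i) \<and> finite {i. c i \<noteq> 0} \<and> x = (\<Sum>i | c i \<noteq> 0. c i)"

definition internal_direct_sum :: "('i \<Rightarrow> 'a::ab_group_add set) \<Rightarrow> bool" where
  "internal_direct_sum F \<longleftrightarrow>
     (\<forall>i. 0 \<in> F i \<and> (\<forall>x\<in>F i. \<forall>y\<in>F i. x - y \<in> F i)) \<and> (\<forall>x. \<exists>!c. decomposes F x c)"

definition component :: "('i \<Rightarrow> 'a::ab_group_add set) \<Rightarrow> 'i \<Rightarrow> 'a \<Rightarrow> 'a" where
  "component F i x = (THE c. decomposes F x c) i"

section \<open>Graded local rings\<close>

definition noetherian :: "'r::comm_ring_1 itself \<Rightarrow> bool" where
  "noetherian _ \<longleftrightarrow>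
     (\<forall>I :: 'r set. module.subspace times I \<longrightarrow> (\<exists>S. finite S \<and> I = module.span times S))"

definition maximal_members :: "'a set set \<Rightarrow> 'a set set" where
  "maximal_members \<A> = {M \<in> \<A>. \<forall>I\<in>\<A>. M \<subseteq> I \<longrightarrow> I = M}"

definition proper_ideals :: "'r::comm_ring_1 set set" where
  "proper_ideals = {I. module.subspace times I \<and> I \<noteq> UNIV}"

definition ring_grading :: "(int \<Rightarrow> 'r::comm_ring_1 set) \<Rightarrow> bool" where
  "ring_grading G \<longleftrightarrow>
     internal_direct_sum G \<and> (\<forall>p q. \<forall>a\<in>G p. \<forall>b\<in>G q. a * b \<in> G (p + q))"

definition homogeneous_ideal :: "(int \<Rightarrow> 'r::comm_ring_1 set) \<Rightarrow> 'r set \<Rightarrow> bool" where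
  "homogeneous_ideal G I \<longleftrightarrow> module.subspace times I \<and> (\<forall>x\<in>I. \<forall>n. component G n x \<in> I)"

text \<open>
  \<open>graded_local_ring \<mm>\<close> says that the ring \<open>'r\<close> is graded local and that \<open>\<mm>\<close> is its
  distinguished ideal.  In the graded case, ``maximal'' means maximal among the proper
  homogeneous ideals.
\<close>

definition graded_local_ring :: "'r::comm_ring_1 set \<Rightarrow> bool" where
  "graded_local_ring \<mm> \<longleftrightarrow>
     noetherian TYPE('r) \<and>
     (maximal_members proper_ideals = {\<mm>} \<or>
      (\<exists>G. ring_grading G \<and> maximal_members {I \<in> proper_ideals. homogeneous_ideal G I} = {\<mm>}))"

section \<open>Free modules, linear maps and quotient modules\<close>

definition free_submodule ::
  "('r::comm_ring_1 \<Rightarrow> 'm::ab_group_add \<Rightarrow> 'm) \<Rightarrow> 'm set \<Rightarrow> bool" where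
  "free_submodule scale N \<longleftrightarrow> (\<exists>B. \<not> module.dependent scale B \<and> module.span scale B = N)"

definition linear_between ::
  "('r \<Rightarrow> 'a::plus \<Rightarrow> 'a) \<Rightarrow> 'a set \<Rightarrow> ('r \<Rightarrow> 'b::plus \<Rightarrow> 'b) \<Rightarrow> 'b set \<Rightarrow> ('a \<Rightarrow> 'b) \<Rightarrow> bool" where
  "linear_between s A t B f \<longleftrightarrow>
     f ` A \<subseteq> B \<and>
     (\<forall>x\<in>A. \<forall>y\<in>A. f (x + y) = f x + f y) \<and> (\<forall>r. \<forall>x\<in>A. f (s r x) = t r (f x))"

text \<open>
  The quotient \<open>Z/N\<close> of submodules \<open>N \<subseteq> Z\<close> is the set of cosets \<open>z +o N\<close>.  Its addition is the
  addition of sets; its zero is \<open>N\<close>.  The summand \<open>N\<close> in the scalar multiplication is needed: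
  \<open>r \<cdot> (z +o N)\<close>, taken elementwise, is in general not a full coset.
\<close>

definition quotient_module :: "'m::ab_group_add set \<Rightarrow> 'm set \<Rightarrow> 'm set set" where
  "quotient_module Z N = {z +o N | z. z \<in> Z}"

definition quotient_scale ::
  "('r \<Rightarrow> 'm::ab_group_add \<Rightarrow> 'm) \<Rightarrow> 'm set \<Rightarrow> 'r \<Rightarrow> 'm set \<Rightarrow> 'm set" where
  "quotient_scale scale N r X = scale r ` X + N"

section \<open>Differential modules\<close>

definition differential_module ::
  "('r::comm_ring_1 \<Rightarrow> 'm::ab_group_add \<Rightarrow> 'm) \<Rightarrow> ('m \<Rightarrow> 'm) \<Rightarrow> bool" where
  "differential_module scale d \<longleftrightarrow> module_hom scale scale d \<and> (\<forall>x. d (d x) = 0)"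

definition homology :: "('m::ab_group_add \<Rightarrow> 'm) \<Rightarrow> 'm set set" where
  "homology d = quotient_module {x. d x = 0} (range d)"

definition homology_scale ::
  "('r \<Rightarrow> 'm::ab_group_add \<Rightarrow> 'm) \<Rightarrow> ('m \<Rightarrow> 'm) \<Rightarrow> 'r \<Rightarrow> 'm set \<Rightarrow> 'm set" where
  "homology_scale scale d = quotient_scale scale (range d)"

definition isomorphic_differential_modules ::
  "('r::comm_ring_1 \<Rightarrow> 'm::ab_group_add \<Rightarrow> 'm) \<Rightarrow> ('m \<Rightarrow> 'm) \<Rightarrow>
   ('r \<Rightarrow> 'n::ab_group_add \<Rightarrow> 'n) \<Rightarrow> ('n \<Rightarrow> 'n) \<Rightarrow> bool" where
  "isomorphic_differential_modules s d t e \<longleftrightarrow>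
     (\<exists>f. module_hom s t f \<and> bij f \<and> (\<forall>x. f (d x) = e (f x)))"

section \<open>Free flags\<close>

definition free_flag ::
  "('r::comm_ring_1 \<Rightarrow> 'm::ab_group_add \<Rightarrow> 'm) \<Rightarrow> ('m \<Rightarrow> 'm) \<Rightarrow> (nat \<Rightarrow> 'm set) \<Rightarrow> bool" where
  "free_flag scale d F \<longleftrightarrow>
     differential_module scale d \<and>
     internal_direct_sum F \<and>
     (\<forall>i. free_submodule scale (F i)) \<and>
     (\<forall>i. d ` F i \<subseteq> module.span scale (\<Union>j<i. F j))"

text \<open>The structure map \<open>A\<^sub>i\<^sub>,\<^sub>j\<close>; only its values on \<open>F i\<close> are meaningful.\<close>

definition structure_map ::
  "(nat \<Rightarrow> 'm::ab_group_add set) \<Rightarrow> ('m \<Rightarrow> 'm) \<Rightarrow> nat \<Rightarrow> nat \<Rightarrow> 'm \<Rightarrow> 'm" where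
  "structure_map F d i j x = component F j (d x)"

text \<open>
  A complex with terms \<open>F i\<close> is given by its differentials \<open>\<delta> i : F i \<rightarrow> F (i - 1)\<close> for \<open>i \<ge> 1\<close>
  (\<open>\<delta> 0\<close> is never used).  It resolves \<open>H(D)\<close> via an augmentation \<open>\<epsilon> : F 0 \<rightarrow> H(D)\<close>, whose kernel
  is the preimage of the coset \<open>im d\<close>.  Exactness includes \<open>\<delta> i \<circ> \<delta> (i + 1) = 0\<close>.
  Minimality is \<open>\<delta> i (F i) \<subseteq> \<mm> F (i - 1)\<close>.  Over a graded ring neither the modules
  nor the maps are required to be graded, so graded minimal resolutions are a special case.
\<close>

definition minimal_free_resolution_of_homology ::
  "'r::comm_ring_1 set \<Rightarrow> ('r \<Rightarrow> 'm::ab_group_add \<Rightarrow> 'm) \<Rightarrow> ('m \<Rightarrow> 'm) \<Rightarrow>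
   (nat \<Rightarrow> 'm set) \<Rightarrow> (nat \<Rightarrow> 'm \<Rightarrow> 'm) \<Rightarrow> bool" where
  "minimal_free_resolution_of_homology \<mm> scale d F \<delta> \<longleftrightarrow>
     (\<forall>i. free_submodule scale (F i)) \<and>
     (\<forall>i\<ge>1. linear_between scale (F i) scale (F (i - 1)) (\<delta> i)) \<and>
     (\<forall>i\<ge>1. {x \<in> F i. \<delta> i x = 0} = \<delta> (i + 1) ` F (i + 1)) \<and>
     (\<exists>\<epsilon>. linear_between scale (F 0) (homology_scale scale d) (homology d) \<epsilon> \<and>
          \<epsilon> ` F 0 = homology d \<and>
          {x \<in> F 0. \<epsilon> x = range d} = \<delta> 1 ` F 1) \<and>
     (\<forall>i\<ge>1. \<delta> i ` F i \<subseteq> module.span scale {scale a x | a x. a \<in> \<mm> \<and> x \<in> F (i - 1)})"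

definition anchored_free_flag ::
  "'r::comm_ring_1 set \<Rightarrow> ('r \<Rightarrow> 'm::ab_group_add \<Rightarrow> 'm) \<Rightarrow> ('m \<Rightarrow> 'm) \<Rightarrow>
   (nat \<Rightarrow> 'm set) \<Rightarrow> (nat \<Rightarrow> 'm \<Rightarrow> 'm) \<Rightarrow> bool" where
  "anchored_free_flag \<mm> scale d F \<delta> \<longleftrightarrow>
     free_flag scale d F \<and>
     minimal_free_resolution_of_homology \<mm> scale d F \<delta> \<and>
     (\<forall>i\<ge>1. \<forall>x\<in>F i. structure_map F d i (i - 1) x = \<delta> i x)"

text \<open>
  The underlying module of the fold is the ambient module, as internal direct sum of the \<open>F i\<close>,
  so only the differential \<open>\<Oplus>\<^sub>i \<delta> i\<close> has to be defined.
\<close>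

definition fold_differential ::
  "(nat \<Rightarrow> 'm::ab_group_add set) \<Rightarrow> (nat \<Rightarrow> 'm \<Rightarrow> 'm) \<Rightarrow> 'm \<Rightarrow> 'm" where
  "fold_differential F \<delta> x = (\<Sum>i | i \<ge> 1 \<and> component F i x \<noteq> 0. \<delta> i (component F i x))"

section \<open>Complete intersections\<close>

definition regular_sequence :: "'r::comm_ring_1 list \<Rightarrow> bool" where
  "regular_sequence xs \<longleftrightarrow>
     (\<forall>i<length xs. \<forall>r. xs ! i * r \<in> module.span times (set (take i xs))
        \<longrightarrow> r \<in> module.span times (set (take i xs))) \<and>
     module.span times (set xs) \<noteq> UNIV"

definition homology_complete_intersection ::
  "('r::comm_ring_1 \<Rightarrow> 'm::ab_group_add \<Rightarrow> 'm) \<Rightarrow> ('m \<Rightarrow> 'm) \<Rightarrow> bool" where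
  "homology_complete_intersection scale d \<longleftrightarrow>
     (\<exists>xs \<aa> f. regular_sequence xs \<and> \<aa> = module.span times (set xs) \<and>
        linear_between (homology_scale scale d) (homology d)
          (quotient_scale times \<aa>) (quotient_module UNIV \<aa>) f \<and>
        bij_betw f (homology d) (quotient_module UNIV \<aa>))"

end

theory Submission
  imports Defs "Jordan_Normal_Form.Determinant" "HOL-Library.Function_Algebras"
begin

text \<open>
  The natural map \<open>F\<^sub>0 / im \<delta>\<^sub>1 \<rightarrow> H(D)\<close> is an isomorphism: the top component of a cycle can be
  removed by a boundary until only degree \<open>0\<close> is left.

  If \<open>im A\<^sub>i\<^sub>,\<^sub>0 \<subseteq> im \<delta>\<^sub>1\<close> for all \<open>i\<close>, a unitriangular isomorphism \<open>D \<rightarrow> Fold(F)\<close> that does not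
  change the component in \<open>F\<^sub>0\<close> is constructed summand by summand: the obstruction is a cycle of
  the fold whose component in \<open>F\<^sub>0\<close> lies in \<open>im \<delta>\<^sub>1\<close>, hence a boundary.

  Conversely, let \<open>\<aa>\<close> be the ideal of the regular sequence.  Comparison with the Koszul complex
  shows that \<open>\<delta>(F) \<subseteq> \<aa>F\<close> and that \<open>\<delta>x \<in> \<aa>\<^sup>2F\<close> implies \<open>x \<in> \<aa>F\<close> in positive degrees.  With
  \<open>d\<^sup>2 = 0\<close>, induction gives \<open>im A\<^sub>i\<^sub>,\<^sub>j \<subseteq> \<aa>F\<^sub>j\<close> for \<open>j \<ge> 1\<close>; for \<open>j = 0\<close> one uses the linear map
  \<open>D \<rightarrow> Fold(F) \<rightarrow> R/\<aa>\<close>, which vanishes on boundaries and on \<open>\<aa>D\<close> and restricts on \<open>F\<^sub>0\<close> to a map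
  with kernel \<open>\<aa>F\<^sub>0\<close>.
\<close>

section \<open>Determinants modulo an ideal\<close>

text \<open>An isomorphism of \<open>D\<close> with its fold may mix all degrees, so it says nothing
  directly about single structure maps. The induced functional to R/\<aa> is blind to \<aa>D: on d x
  it sees just \<open>A_{i,0} x\<close>, provided that the higher components of d x lie in \<aa>F.
  This is why all structure maps have to be controlled. In degree j - 1, d(d x) = 0 reads
  \<open>\<delta>_j A_{i,j} = - \<Sum> A_{k,j-1} A_{i,k}\<close> over j < k < i, and the right side
  has values in \<aa>\<aa>F. For j = 1 the factors \<open>A_{k,0}\<close> occur, so the functional
  is used at every stage of the induction on i, not only at its end. Getting back from \<aa>\<aa>F
  to \<aa>F is where the complete intersection enters. In the graded case \<mm> need not lie in the
  Jacobson radical and the maps need not be homogeneous, so a map that is invertible modulo \<mm>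
  need not be invertible. Hence \<open>F\<close> is never identified with a Koszul complex;
  congruences modulo two ideals take the place of an isomorphism.\<close>

interpretation ideal: Modules.module "times :: 'r::comm_ring_1 \<Rightarrow> 'r \<Rightarrow> 'r"
  by unfold_locales (simp_all add: algebra_simps)

declare ideal.scale_scale [simp del]

lemma prod_diff_in_ideal:
  assumes J: "ideal.subspace J" and "finite S" "\<And>i. i \<in> S \<Longrightarrow> f i - g i \<in> J"
  shows "prod f S - prod g S \<in> J"
  using assms(2,3)
proof (induction S rule: finite_induct)
  case empty
  then show ?case using ideal.subspace_0[OF J] by simp
next
  case (insert i S)
  have "f i * (prod f S - prod g S) + prod g S * (f i - g i) \<in> J"
    using insert by (intro ideal.subspace_add[OF J] ideal.subspace_scale[OF J]) auto
  moreover have "prod f (insert i S) - prod g (insert i S)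
      = f i * (prod f S - prod g S) + prod g S * (f i - g i)"
    using insert.hyps by (simp add: algebra_simps)
  ultimately show ?case by simp
qed

lemma det_diff_in_ideal:
  fixes A B :: "'r::comm_ring_1 mat"
  assumes J: "ideal.subspace J" and A: "A \<in> carrier_mat n n" and B: "B \<in> carrier_mat n n"
    and AB: "\<And>i j. i < n \<Longrightarrow> j < n \<Longrightarrow> A $$ (i, j) - B $$ (i, j) \<in> J"
  shows "det A - det B \<in> J"
proof -
  have "(\<Sum>p | p permutes {0..<n}. signof p *
      ((\<Prod>i = 0..<n. A $$ (i, p i)) - (\<Prod>i = 0..<n. B $$ (i, p i)))) \<in> J"
    using AB by (intro ideal.subspace_sum[OF J] ideal.subspace_scale[OF J] prod_diff_in_ideal[OF J])
      (auto simp: permutes_in_image dest: permutes_in_image)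
  then show ?thesis
    by (simp add: det_def'[OF A] det_def'[OF B] right_diff_distrib sum_subtractf)
qed

lemma det_eq_0_if_zero_row:
  fixes A :: "'r::comm_ring_1 mat"
  assumes A: "A \<in> carrier_mat n n" and "k < n" "\<And>j. j < n \<Longrightarrow> A $$ (k, j) = 0"
  shows "det A = 0"
proof -
  have "(\<Prod>i = 0..<n. A $$ (i, p i)) = 0" if "p permutes {0..<n}" for p
  proof -
    have "p k < n" using permutes_in_image[OF that, of k] assms(2) by simp
    then show ?thesis using assms(2,3) by (intro prod_zero) (auto intro!: bexI[of _ k])
  qed
  then show ?thesis by (simp add: det_def'[OF A])
qed

lemma sum_if_less:
  fixes g :: "nat \<Rightarrow> 'r::comm_monoid_add"
  assumes "k \<le> n" shows "(\<Sum>l = 0..<n. if l < k then g l else 0) = (\<Sum>l<k. g l)"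
  using assms by (intro sum.mono_neutral_cong_right) auto

text \<open>Both matrices are padded with zeros to size \<open>k\<close>. If \<open>n < k\<close>,
  the padded \<open>A\<close> has a zero row, so the determinant of the product is 0, although it is
  congruent to 1 modulo \<open>J\<close>. Congruences in the ring itself spare a quotient ring,
  whose type would depend on \<open>J\<close>.\<close>

lemma dim_le_if_left_inverse_mod_ideal:
  fixes A B :: "nat \<Rightarrow> nat \<Rightarrow> 'r::comm_ring_1"
  assumes J: "ideal.subspace J" "1 \<notin> J"
    and BA: "\<And>i j. i < k \<Longrightarrow> j < k \<Longrightarrow> (\<Sum>l<n. B i l * A l j) - (if i = j then 1 else 0) \<in> J"
  shows "k \<le> n"
proof (rule ccontr)
  assume "\<not> k \<le> n"
  define A' where "A' = mat k k (\<lambda>(l, j). if l < n then A l j else 0)"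
  define B' where "B' = mat k k (\<lambda>(i, l). if l < n then B i l else 0)"
  have c: "A' \<in> carrier_mat k k" "B' \<in> carrier_mat k k" by (simp_all add: A'_def B'_def)
  have "(B' * A') $$ (i, j) - 1\<^sub>m k $$ (i, j) \<in> J" if "i < k" "j < k" for i j
  proof -
    have "(B' * A') $$ (i, j) = (\<Sum>l = 0..<k. if l < n then B i l * A l j else 0)"
      using that by (auto simp: A'_def B'_def scalar_prod_def intro!: sum.cong)
    then show ?thesis using BA[OF that] that \<open>\<not> k \<le> n\<close> by (simp add: sum_if_less)
  qed
  then have "det (B' * A') - det (1\<^sub>m k) \<in> J"
    using c by (intro det_diff_in_ideal[OF J(1), of _ k]) auto
  moreover have "det A' = 0"
    using \<open>\<not> k \<le> n\<close> by (intro det_eq_0_if_zero_row[OF c(1), of n]) (auto simp: A'_def)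
  ultimately have "- 1 \<in> J" by (simp add: det_mult[OF c(2,1)])
  then show False using ideal.subspace_neg[OF J(1)] J(2) by fastforce
qed

text \<open>Padding to size \<open>n\<close> makes the determinant of \<open>A\<close> a unit modulo
  \<open>J\<close>, with inverse the determinant of the padded \<open>B\<close>. The adjugate then
  turns the hypothesis on \<open>A x\<close> into \<open>det A' * x m \<in> J\<close>. For
  \<open>k > n\<close> a right inverse would not give injectivity.\<close>

lemma injective_mod_ideal_if_right_inverse_mod_ideal:
  fixes A B :: "nat \<Rightarrow> nat \<Rightarrow> 'r::comm_ring_1"
  assumes J: "ideal.subspace J" and "k \<le> n"
    and AB: "\<And>i j. i < n \<Longrightarrow> j < n \<Longrightarrow> (\<Sum>l<k. A i l * B l j) - (if i = j then 1 else 0) \<in> J"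
    and Ax: "\<And>i. i < n \<Longrightarrow> (\<Sum>l<k. A i l * x l) \<in> J"
    and "m < k"
  shows "x m \<in> J"
proof -
  define A' where "A' = mat n n (\<lambda>(i, l). if l < k then A i l else 0)"
  define B' where "B' = mat n n (\<lambda>(l, j). if l < k then B l j else 0)"
  define v where "v = vec n (\<lambda>l. if l < k then x l else 0)"
  have c: "A' \<in> carrier_mat n n" "B' \<in> carrier_mat n n" "v \<in> carrier_vec n"
    by (simp_all add: A'_def B'_def v_def)
  note adj = adj_mat[OF c(1)]
  have "(A' * B') $$ (i, j) - 1\<^sub>m n $$ (i, j) \<in> J" if "i < n" "j < n" for i j
  proof -
    have "(A' * B') $$ (i, j) = (\<Sum>l = 0..<n. if l < k then A i l * B l j else 0)"
      using that by (auto simp: A'_def B'_def scalar_prod_def intro!: sum.cong)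
    then show ?thesis using AB[OF that] that \<open>k \<le> n\<close> by (simp add: sum_if_less)
  qed
  then have "det (A' * B') - det (1\<^sub>m n) \<in> J"
    using c by (intro det_diff_in_ideal[OF J, of _ n]) auto
  then have det: "det A' * det B' - 1 \<in> J" by (simp add: det_mult[OF c(1,2)])
  have A'v: "(A' *\<^sub>v v) $ i \<in> J" if "i < n" for i
  proof -
    have "(A' *\<^sub>v v) $ i = (\<Sum>l = 0..<n. if l < k then A i l * x l else 0)"
      using that by (auto simp: A'_def v_def scalar_prod_def intro!: sum.cong)
    then show ?thesis using Ax[OF that] \<open>k \<le> n\<close> by (simp add: sum_if_less)
  qed
  have "m < n" using assms by simp
  have "det A' * x m = ((det A' \<cdot>\<^sub>m 1\<^sub>m n) *\<^sub>v v) $ m"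
    using \<open>m < n\<close> \<open>m < k\<close> by (simp add: v_def)
  also have "\<dots> = (adj_mat A' *\<^sub>v (A' *\<^sub>v v)) $ m"
    unfolding adj(3)[symmetric] using c adj(1) by (simp add: assoc_mult_mat_vec[of _ n n _ n])
  also have "\<dots> = (\<Sum>i = 0..<n. adj_mat A' $$ (m, i) * (A' *\<^sub>v v) $ i)"
    using \<open>m < n\<close> adj(1) c by (simp add: scalar_prod_def)
  also have "\<dots> \<in> J"
    using A'v by (intro ideal.subspace_sum[OF J] ideal.subspace_scale[OF J]) auto
  finally have "det A' * x m \<in> J" .
  then have "det B' * (det A' * x m) - x m * (det A' * det B' - 1) \<in> J"
    by (rule ideal.subspace_diff[OF J ideal.subspace_scale[OF J] ideal.subspace_scale[OF J det]])
  then show ?thesis by (simp add: algebra_simps)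
qed

section \<open>Modules over a commutative ring\<close>

subsection \<open>Linear maps between submodules\<close>

lemma linear_between_mem: "linear_between s A t B f \<Longrightarrow> x \<in> A \<Longrightarrow> f x \<in> B"
  by (auto simp: linear_between_def)

lemma linear_between_add:
  "linear_between s A t B f \<Longrightarrow> x \<in> A \<Longrightarrow> y \<in> A \<Longrightarrow> f (x + y) = f x + f y"
  by (auto simp: linear_between_def)

lemma linear_between_scale: "linear_between s A t B f \<Longrightarrow> x \<in> A \<Longrightarrow> f (s r x) = t r (f x)"
  by (auto simp: linear_between_def)

lemma linear_between_compose:
  "linear_between s A t B f \<Longrightarrow> linear_between t B u C g \<Longrightarrow> linear_between s A u C (\<lambda>x. g (f x))"
  by (auto simp: linear_between_def image_subset_iff)

lemma linear_between_ident: "linear_between s A s A (\<lambda>x. x)"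
  by (simp add: linear_between_def)

lemma linear_between_if_module_hom:
  "module_hom s t f \<Longrightarrow> (\<And>x. x \<in> A \<Longrightarrow> f x \<in> B) \<Longrightarrow> linear_between s A t B f"
  unfolding linear_between_def by (auto simp: module_hom.add module_hom.scale)

context module_pair
begin

lemma linear_between_minus:
  assumes "linear_between s1 A s2 B f" "x \<in> A"
  shows "f (- x) = - f x"
  using linear_between_scale[OF assms, of "- 1"] by simp

lemma linear_between_diff:
  assumes f: "linear_between s1 A s2 B f" and A: "m1.subspace A" and xy: "x \<in> A" "y \<in> A"
  shows "f (x - y) = f x - f y"
  using linear_between_add[OF f xy(1) m1.subspace_neg[OF A xy(2)]] linear_between_minus[OF f xy(2)]
  by simp

lemma linear_between_zero:
  assumes f: "linear_between s1 A s2 B f" and A: "m1.subspace A"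
  shows "f 0 = 0"
  using linear_between_diff[OF f A m1.subspace_0[OF A] m1.subspace_0[OF A]] by simp

lemma linear_between_sum:
  assumes f: "linear_between s1 A s2 B f" and A: "m1.subspace A"
    and "\<And>i. i \<in> S \<Longrightarrow> x i \<in> A"
  shows "f (\<Sum>i\<in>S. x i) = (\<Sum>i\<in>S. f (x i))"
  using assms(3)
proof (induction S rule: infinite_finite_induct)
  case (insert i S)
  then show ?case
    using linear_between_add[OF f, of "x i" "sum x S"] m1.subspace_sum[OF A, of S x] by simp
qed (simp_all add: linear_between_zero[OF f A])

lemma linear_between_diff_fun:
  assumes "linear_between s1 A s2 B f" "linear_between s1 A s2 B g" "m2.subspace B"
  shows "linear_between s1 A s2 B (\<lambda>x. f x - g x)"
  using assms unfolding linear_between_def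
  by (auto simp: m2.scale_right_diff_distrib intro: m2.subspace_diff)

end

subsection \<open>Products of an ideal and a submodule\<close>

definition ideal_times ::
  "('r::comm_ring_1 \<Rightarrow> 'm::ab_group_add \<Rightarrow> 'm) \<Rightarrow> 'r set \<Rightarrow> 'm set \<Rightarrow> 'm set" where
  "ideal_times s J N = Modules.module.span s {s a x | a x. a \<in> J \<and> x \<in> N}"

context Modules.module
begin

lemma subspace_ideal_times [simp]: "subspace (ideal_times scale J N)"
  by (simp add: ideal_times_def)

lemma scale_mem_ideal_times: "a \<in> J \<Longrightarrow> x \<in> N \<Longrightarrow> scale a x \<in> ideal_times scale J N"
  unfolding ideal_times_def by (intro span_base) auto

lemma ideal_times_le: 
  assumes "subspace M" "\<And>a x. a \<in> J \<Longrightarrow> x \<in> N \<Longrightarrow> scale a x \<in> M"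
  shows "ideal_times scale J N \<subseteq> M"
  unfolding ideal_times_def using assms by (intro span_minimal) auto

lemma ideal_times_subset: "subspace N \<Longrightarrow> ideal_times scale J N \<subseteq> N"
  by (intro ideal_times_le) (auto intro: subspace_scale)

end

text \<open>\<open>X\<close> is an arbitrary subset of the domain, so the lemma can be iterated to
  treat J(JN) and can use that \<open>f\<close> has smaller values on \<open>X\<close> than on all
  of \<open>A\<close>.\<close>

lemma (in module_pair) linear_between_image_ideal_times:
  assumes f: "linear_between s1 A s2 B f" and A: "m1.subspace A" and X: "X \<subseteq> A"
    and Y: "\<And>x. x \<in> X \<Longrightarrow> f x \<in> Y" and x: "x \<in> ideal_times s1 J X"
  shows "f x \<in> ideal_times s2 J Y"
proof -
  have "ideal_times s1 J X \<subseteq> {x \<in> A. f x \<in> ideal_times s2 J Y}"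
  proof (rule m1.ideal_times_le)
    show "m1.subspace {x \<in> A. f x \<in> ideal_times s2 J Y}"
      using f A unfolding m1.subspace_def
      by (auto simp: linear_between_add[OF f] linear_between_scale[OF f] linear_between_zero[OF f A]
          intro: m2.subspace_0 m2.subspace_add m2.subspace_scale)
    show "s1 a y \<in> {x \<in> A. f x \<in> ideal_times s2 J Y}" if "a \<in> J" "y \<in> X" for a y
      using that X Y by (auto simp: linear_between_scale[OF f] subset_iff
          intro: m2.scale_mem_ideal_times m1.subspace_scale[OF A])
  qed
  then show ?thesis using x by auto
qed

subsection \<open>Free modules in coordinates\<close>

text \<open>The index set and the coordinates are data, so that an abstract basis with
  \<open>representation\<close> and the standard basis of the Koszul chains are treated alike.
  \<open>I\<close> may be infinite: no rank of a module in a resolution is presupposed.\<close>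

locale free_basis = Modules.module scale
  for scale :: "'r::comm_ring_1 \<Rightarrow> 'm::ab_group_add \<Rightarrow> 'm" +
  fixes N :: "'m set" and I :: "'i set" and e :: "'i \<Rightarrow> 'm" and coord :: "'m \<Rightarrow> 'i \<Rightarrow> 'r"
  assumes subspace: "subspace N"
    and e_mem: "i \<in> I \<Longrightarrow> e i \<in> N"
    and finite_support: "x \<in> N \<Longrightarrow> finite {i \<in> I. coord x i \<noteq> 0}"
    and expansion: "x \<in> N \<Longrightarrow> x = (\<Sum>i | i \<in> I \<and> coord x i \<noteq> 0. scale (coord x i) (e i))"
    and coord_linear: "i \<in> I \<Longrightarrow> linear_between scale N times UNIV (\<lambda>x. coord x i)"
    and coord_e: "i \<in> I \<Longrightarrow> j \<in> I \<Longrightarrow> coord (e i) j = (if i = j then 1 else 0)"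
begin

sublocale to_ring: module_pair scale "times :: 'r \<Rightarrow> _"
  by unfold_locales

lemma expansion_superset:
  assumes "x \<in> N" "finite S" "S \<subseteq> I" "{i \<in> I. coord x i \<noteq> 0} \<subseteq> S"
  shows "x = (\<Sum>i\<in>S. scale (coord x i) (e i))"
proof -
  have "(\<Sum>i | i \<in> I \<and> coord x i \<noteq> 0. scale (coord x i) (e i)) = (\<Sum>i\<in>S. scale (coord x i) (e i))"
    using assms by (intro sum.mono_neutral_left) auto
  then show ?thesis using expansion[OF assms(1)] by simp
qed

lemma coord_sum:
  assumes "i \<in> I" "\<And>j. j \<in> S \<Longrightarrow> x j \<in> N"
  shows "coord (\<Sum>j\<in>S. scale (c j) (x j)) i = (\<Sum>j\<in>S. c j * coord (x j) i)"
proof -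
  have "coord (\<Sum>j\<in>S. scale (c j) (x j)) i = (\<Sum>j\<in>S. coord (scale (c j) (x j)) i)"
    using assms subspace
    by (intro to_ring.linear_between_sum[OF coord_linear]) (auto intro: subspace_scale)
  also have "\<dots> = (\<Sum>j\<in>S. c j * coord (x j) i)"
    using assms by (intro sum.cong) (auto simp: linear_between_scale[OF coord_linear])
  finally show ?thesis .
qed

lemma mem_ideal_times_iff:
  assumes J: "ideal.subspace J" and x: "x \<in> N"
  shows "x \<in> ideal_times scale J N \<longleftrightarrow> (\<forall>i\<in>I. coord x i \<in> J)"
proof safe
  fix i assume i: "i \<in> I" and "x \<in> ideal_times scale J N"
  then have "coord x i \<in> ideal_times times J UNIV"
    by (intro to_ring.linear_between_image_ideal_times[OF coord_linear subspace]) auto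
  moreover have "ideal_times times J UNIV \<subseteq> J"
    using ideal.subspace_scale[OF J] by (intro ideal.ideal_times_le[OF J]) (metis mult.commute)
  ultimately show "coord x i \<in> J" by blast
next
  assume "\<forall>i\<in>I. coord x i \<in> J"
  then have "(\<Sum>i | i \<in> I \<and> coord x i \<noteq> 0. scale (coord x i) (e i)) \<in> ideal_times scale J N"
    by (intro subspace_sum scale_mem_ideal_times) (auto intro: e_mem)
  then show "x \<in> ideal_times scale J N" using expansion[OF x] by simp
qed

lemma linear_extension:
  assumes t: "Modules.module t" and M: "Modules.module.subspace t M" and g: "\<And>i. i \<in> I \<Longrightarrow> g i \<in> M"
  shows "\<exists>w. linear_between scale N t M w \<and> (\<forall>i\<in>I. w (e i) = g i)"
proof -
  interpret t: Modules.module t by (fact t)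
  define w where "w x = (\<Sum>i | i \<in> I \<and> coord x i \<noteq> 0. t (coord x i) (g i))" for x
  have w: "w x = (\<Sum>i\<in>S. t (coord x i) (g i))"
    if "x \<in> N" "finite S" "S \<subseteq> I" "{i \<in> I. coord x i \<noteq> 0} \<subseteq> S" for x S
    unfolding w_def using that by (intro sum.mono_neutral_left) auto
  have "linear_between scale N t M w"
    unfolding linear_between_def
  proof (intro conjI ballI allI)
    show "w ` N \<subseteq> M"
      unfolding w_def using g by (auto intro!: t.subspace_sum[OF M] t.subspace_scale[OF M])
    fix x assume x: "x \<in> N"
    show "w (x + y) = w x + w y" if y: "y \<in> N" for y
    proof -
      define S where "S = {i \<in> I. coord x i \<noteq> 0} \<union> {i \<in> I. coord y i \<noteq> 0}"
      have c: "coord (x + y) i = coord x i + coord y i" if "i \<in> I" for i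
        using linear_between_add[OF coord_linear[OF that] x y] .
      have S: "finite S" "S \<subseteq> I" using finite_support x y by (auto simp: S_def)
      have "w (x + y) = (\<Sum>i\<in>S. t (coord (x + y) i) (g i))"
        using x y S subspace c by (intro w) (auto simp: S_def intro: subspace_add)
      also have "\<dots> = (\<Sum>i\<in>S. t (coord x i) (g i)) + (\<Sum>i\<in>S. t (coord y i) (g i))"
        unfolding sum.distrib[symmetric] using S c
        by (intro sum.cong) (auto simp: t.scale_left_distrib)
      also have "\<dots> = w x + w y"
        using x y S by (subst (1 2) w[of _ S]) (auto simp: S_def)
      finally show ?thesis .
    qed
    show "w (scale r x) = t r (w x)" for r
    proof -
      define S where "S = {i \<in> I. coord x i \<noteq> 0}"
      have c: "coord (scale r x) i = r * coord x i" if "i \<in> I" for i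
        using linear_between_scale[OF coord_linear[OF that] x] .
      have S: "finite S" "S \<subseteq> I" using finite_support x by (auto simp: S_def)
      have "w (scale r x) = (\<Sum>i\<in>S. t (coord (scale r x) i) (g i))"
        using x S subspace c by (intro w) (auto simp: S_def intro: subspace_scale)
      also have "\<dots> = (\<Sum>i\<in>S. t r (t (coord x i) (g i)))"
        using S c by (intro sum.cong) auto
      also have "\<dots> = t r (w x)"
        using x S by (subst w[of _ S]) (auto simp: S_def t.scale_sum_right)
      finally show ?thesis .
    qed
  qed
  moreover have "w (e i) = g i" if i: "i \<in> I" for i
  proof -
    have "w (e i) = (\<Sum>j\<in>{i}. t (coord (e i) j) (g j))"
      using i e_mem by (intro w) (auto simp: coord_e split: if_splits)
    then show ?thesis using i by (simp add: coord_e)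
  qed
  ultimately show ?thesis by blast
qed

lemma linear_between_expansion:
  assumes "Modules.module t" and h: "linear_between scale N t M h" and x: "x \<in> N"
    and S: "finite S" "S \<subseteq> I" "{i \<in> I. coord x i \<noteq> 0} \<subseteq> S"
  shows "h x = (\<Sum>i\<in>S. t (coord x i) (h (e i)))"
proof -
  interpret t: Modules.module t by fact
  interpret pair: module_pair scale t by unfold_locales
  have "h x = h (\<Sum>i\<in>S. scale (coord x i) (e i))"
    using expansion_superset[OF x S] by simp
  also have "\<dots> = (\<Sum>i\<in>S. h (scale (coord x i) (e i)))"
    using S by (intro pair.linear_between_sum[OF h subspace] subspace_scale[OF subspace])
      (auto intro: e_mem)
  also have "\<dots> = (\<Sum>i\<in>S. t (coord x i) (h (e i)))"
    using S by (intro sum.cong) (auto simp: linear_between_scale[OF h e_mem])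
  finally show ?thesis .
qed

lemma linear_between_eqI:
  assumes t: "Modules.module t" and f: "linear_between scale N t M f"
    and g: "linear_between scale N t M g" and "\<And>i. i \<in> I \<Longrightarrow> f (e i) = g (e i)" and x: "x \<in> N"
  shows "f x = g x"
  unfolding linear_between_expansion[OF t f x finite_support[OF x] _ order_refl, simplified]
    linear_between_expansion[OF t g x finite_support[OF x] _ order_refl, simplified]
  using assms(4) by (intro sum.cong) auto

lemma lift_along:
  assumes t: "Modules.module t" and M: "Modules.module.subspace t M"
    and u: "linear_between scale N t L u" and v: "linear_between t M t L v"
    and "u ` N \<subseteq> v ` M"
  shows "\<exists>w. linear_between scale N t M w \<and> (\<forall>x\<in>N. v (w x) = u x)"
proof -
  have "\<forall>i\<in>I. \<exists>y\<in>M. v y = u (e i)" using assms(5) e_mem by (metis image_iff image_subset_iff)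
  then obtain g where g: "\<And>i. i \<in> I \<Longrightarrow> g i \<in> M" "\<And>i. i \<in> I \<Longrightarrow> v (g i) = u (e i)" by metis
  obtain w where w: "linear_between scale N t M w" "\<forall>i\<in>I. w (e i) = g i"
    using linear_extension[OF t M, of g] g(1) by blast
  have "v (w x) = u x" if "x \<in> N" for x
    using linear_between_eqI[OF t linear_between_compose[OF w(1) v] u _ that] w(2) g(2) by simp
  then show ?thesis using w by blast
qed

lemma free_submodule:
  assumes "(0::'r) \<noteq> 1"
  shows "free_submodule scale N"
proof -
  have coord_e': "coord (e i) j = (if e i = e j then 1 else 0)" if "i \<in> I" "j \<in> I" for i j
    using assms that coord_e[OF that] coord_e[OF that(2) that(2)] by (auto split: if_splits)
  have "independent (e ` I)"
    unfolding independent_explicit_module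
  proof (intro allI impI)
    fix T u v
    assume T: "finite T" "T \<subseteq> e ` I" "(\<Sum>v\<in>T. scale (u v) v) = 0" "v \<in> T"
    then obtain i where i: "i \<in> I" "v = e i" by blast
    have "0 = coord (\<Sum>v\<in>T. scale (u v) v) i"
      using T(3) to_ring.linear_between_zero[OF coord_linear[OF i(1)] subspace] by simp
    also have "\<dots> = (\<Sum>w\<in>T. u w * coord w i)"
      using T(2) e_mem by (intro coord_sum i(1)) auto
    also have "\<dots> = (\<Sum>w\<in>T. if w = v then u w else 0)"
      using T(2) i by (intro sum.cong) (auto simp: coord_e')
    also have "\<dots> = u v" using T(1,4) by simp
    finally show "u v = 0" by simp
  qed
  moreover have "span (e ` I) = N"
  proof
    show "span (e ` I) \<subseteq> N" using e_mem by (intro span_minimal subspace) auto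
    show "N \<subseteq> span (e ` I)"
    proof
      fix x assume "x \<in> N"
      moreover have "(\<Sum>i | i \<in> I \<and> coord x i \<noteq> 0. scale (coord x i) (e i)) \<in> span (e ` I)"
        by (intro span_sum span_scale span_base) auto
      ultimately show "x \<in> span (e ` I)" using expansion by metis
    qed
  qed
  ultimately show ?thesis unfolding free_submodule_def by blast
qed

end

lemma free_basis_if_free_submodule:
  assumes "Modules.module scale" "free_submodule scale N"
  shows "\<exists>B. free_basis scale N B (\<lambda>b. b) (Modules.module.representation scale B)"
proof -
  interpret Modules.module scale by fact
  obtain B where B: "independent B" "span B = N"
    using assms(2) by (auto simp: free_submodule_def)
  have "free_basis scale N B (\<lambda>b. b) (representation B)"
  proof
    show "subspace N" using B(2) by auto
    show "linear_between scale N times UNIV (\<lambda>x. representation B x i)" for i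
      using B by (auto simp: linear_between_def representation_add representation_scale)
    show "finite {i \<in> B. representation B x i \<noteq> 0}" if "x \<in> N" for x
      using finite_representation[of B x] by (rule finite_subset[rotated]) auto
    show "x = (\<Sum>i | i \<in> B \<and> representation B x i \<noteq> 0. scale (representation B x i) i)"
      if "x \<in> N" for x
    proof -
      have "{i \<in> B. representation B x i \<noteq> 0} = {i. representation B x i \<noteq> 0}"
        using representation_ne_zero by auto
      then show ?thesis using sum_nonzero_representation_eq[of B x] B that by simp
    qed
    show "representation B i j = (if i = j then 1 else 0)" if "i \<in> B" "j \<in> B" for i j
      using representation_basis[OF B(1) that(1)] by auto
    show "i \<in> N" if "i \<in> B" for i using that B span_base by auto
  qed
  then show ?thesis by blast
qed

section \<open>Free resolutions\<close>

lemma coord_linear_image: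
  assumes N: "free_basis s N I e coord" and M: "free_basis t M L e' coord'" and "finite L"
    and g: "linear_between t M s N g" and "i \<in> I" "y \<in> M"
  shows "coord (g y) i = (\<Sum>l\<in>L. coord (g (e' l)) i * coord' y l)"
proof -
  interpret N: free_basis s N I e coord by fact
  interpret M: free_basis t M L e' coord' by fact
  have "coord (g y) i = (\<Sum>l\<in>L. coord' y l * coord (g (e' l)) i)"
    using assms(3,6)
    by (intro M.linear_between_expansion[OF ideal.module_axioms
          linear_between_compose[OF g N.coord_linear[OF assms(5)]]]) auto
  then show ?thesis by (simp add: mult.commute)
qed

text \<open>
  Determinants replace Nakayama's lemma here: no ideal needs to lie in the Jacobson radical.
  Modulo the proper ideal \<open>\<mm>\<close>, the map \<open>f\<close> has a left inverse, so \<open>N\<close> has at most the rank of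
  \<open>M\<close>; hence a right inverse of \<open>f\<close> modulo \<open>J\<close> is a two-sided one.
\<close>

lemma mem_ideal_times_if_image_mem:
  assumes N: "free_basis s N I e coord" and M: "free_basis t M L e' coord'" and L: "finite L"
    and f: "linear_between s N t M f" and g: "linear_between t M s N g"
    and \<mm>: "ideal.subspace \<mm>" "1 \<notin> \<mm>" and J: "ideal.subspace J"
    and gf: "\<And>x. x \<in> N \<Longrightarrow> g (f x) - x \<in> ideal_times s \<mm> N"
    and fg: "\<And>y. y \<in> M \<Longrightarrow> f (g y) - y \<in> ideal_times t J M"
    and x: "x \<in> N" "f x \<in> ideal_times t J M"
  shows "x \<in> ideal_times s J N"
proof -
  interpret N: free_basis s N I e coord by fact
  interpret M: free_basis t M L e' coord' by fact
  define n where "n = card L"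
  obtain b where "bij_betw b {0..<n} L" using ex_bij_betw_nat_finite[OF L] n_def by blast
  then have b: "bij_betw b {..<n} L" by (simp add: atLeast0LessThan)
  \<comment> \<open>Finite subsets of \<open>I\<close> are bounded first, since \<open>I\<close> is
    not yet known to be finite; the bound itself excludes an infinite \<open>I\<close>. Restricting
    the matrix of \<open>g \<circ> f\<close> to indices in \<open>I'\<close> preserves its
    congruence to the identity modulo \<open>\<mm>\<close>.\<close>
  have card_le: "card I' \<le> n" if I': "finite I'" "I' \<subseteq> I" for I'
  proof -
    define k where "k = card I'"
    obtain c where "bij_betw c {0..<k} I'" using ex_bij_betw_nat_finite[OF I'(1)] k_def by blast
    then have c: "bij_betw c {..<k} I'" by (simp add: atLeast0LessThan)
    have "k \<le> n"
    proof (rule dim_le_if_left_inverse_mod_ideal[OF \<mm>])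
      fix i j assume ij: "i < k" "j < k"
      then have cI: "c i \<in> I" "c j \<in> I" using c I' by (auto simp: bij_betw_def)
      have eq: "c i = c j \<longleftrightarrow> i = j" using c ij by (auto simp: bij_betw_def inj_on_def)
      have fe: "f (e (c j)) \<in> M" by (rule linear_between_mem[OF f N.e_mem[OF cI(2)]])
      have "(\<Sum>l<n. coord (g (e' (b l))) (c i) * coord' (f (e (c j))) (b l))
          = coord (g (f (e (c j)))) (c i)"
        unfolding coord_linear_image[OF N M L g cI(1) fe] by (rule sum.reindex_bij_betw[OF b])
      moreover have "coord (g (f (e (c j))) - e (c j)) (c i) \<in> \<mm>"
        using gf[OF N.e_mem[OF cI(2)]] N.ideal_times_subset[OF N.subspace]
          N.mem_ideal_times_iff[OF \<mm>(1)] cI(1) by blast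
      ultimately show "(\<Sum>l<n. coord (g (e' (b l))) (c i) * coord' (f (e (c j))) (b l))
          - (if i = j then 1 else 0) \<in> \<mm>"
        using N.to_ring.linear_between_diff[OF N.coord_linear[OF cI(1)] N.subspace
            linear_between_mem[OF g fe] N.e_mem[OF cI(2)]]
        by (simp add: N.coord_e[OF cI(2,1)] eq eq_commute[of "c j"])
    qed
    then show ?thesis by (simp add: k_def)
  qed
  have I: "finite I"
  proof (rule ccontr)
    assume "infinite I"
    then obtain I' where "I' \<subseteq> I" "finite I'" "card I' = Suc n"
      using infinite_arbitrarily_large by blast
    then show False using card_le[of I'] by simp
  qed
  define k where "k = card I"
  obtain c where "bij_betw c {0..<k} I" using ex_bij_betw_nat_finite[OF I] k_def by blast
  then have c: "bij_betw c {..<k} I" by (simp add: atLeast0LessThan)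
  have bL: "b i \<in> L" if "i < n" for i using b that by (auto simp: bij_betw_def)
  \<comment> \<open>The roles are exchanged: \<open>f \<circ> g\<close> is the identity modulo
    \<open>J\<close>, so the matrix of \<open>g\<close> is a right inverse of that of
    \<open>f\<close>, and \<open>k \<le> n\<close> makes \<open>f\<close> injective modulo
    \<open>J\<close>.\<close>
  have "coord x (c m) \<in> J" if "m < k" for m
  proof (rule injective_mod_ideal_if_right_inverse_mod_ideal[OF J _ _ _ that])
    show "k \<le> n" using card_le[OF I] by (simp add: k_def)
    show "(\<Sum>l<k. coord' (f (e (c l))) (b i) * coord (g (e' (b j))) (c l))
        - (if i = j then 1 else 0) \<in> J" if ij: "i < n" "j < n" for i j
    proof -
      have eq: "b i = b j \<longleftrightarrow> i = j" using b ij by (auto simp: bij_betw_def inj_on_def)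
      have ge: "g (e' (b j)) \<in> N" by (rule linear_between_mem[OF g M.e_mem[OF bL[OF ij(2)]]])
      have "(\<Sum>l<k. coord' (f (e (c l))) (b i) * coord (g (e' (b j))) (c l))
          = coord' (f (g (e' (b j)))) (b i)"
        unfolding coord_linear_image[OF M N I f bL[OF ij(1)] ge] by (rule sum.reindex_bij_betw[OF c])
      moreover have "coord' (f (g (e' (b j))) - e' (b j)) (b i) \<in> J"
        using fg[OF M.e_mem[OF bL[OF ij(2)]]] M.ideal_times_subset[OF M.subspace]
          M.mem_ideal_times_iff[OF J] bL[OF ij(1)] by blast
      ultimately show ?thesis
        using M.to_ring.linear_between_diff[OF M.coord_linear[OF bL[OF ij(1)]] M.subspace
            linear_between_mem[OF f ge] M.e_mem[OF bL[OF ij(2)]]]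
        by (simp add: M.coord_e[OF bL[OF ij(2)] bL[OF ij(1)]] eq eq_commute[of "b j"])
    qed
    show "(\<Sum>l<k. coord' (f (e (c l))) (b i) * coord x (c l)) \<in> J" if i: "i < n" for i
    proof -
      have "(\<Sum>l<k. coord' (f (e (c l))) (b i) * coord x (c l)) = coord' (f x) (b i)"
        unfolding coord_linear_image[OF M N I f bL[OF i] x(1)] by (rule sum.reindex_bij_betw[OF c])
      then show ?thesis
        using x(2) M.mem_ideal_times_iff[OF J linear_between_mem[OF f x(1)]] bL[OF i] by simp
    qed
  qed
  then have "\<forall>i\<in>I. coord x i \<in> J" using c by (auto simp: bij_betw_def)
  then show ?thesis using N.mem_ideal_times_iff[OF J x(1)] by blast
qed

subsection \<open>Comparison of free resolutions\<close>

lemma free_submodule_lift_along: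
  assumes "Modules.module s" "free_submodule s N" "Modules.module t" "Modules.module.subspace t M"
    and "linear_between s N t L u" "linear_between t M t L v" "u ` N \<subseteq> v ` M"
  shows "\<exists>w. linear_between s N t M w \<and> (\<forall>x\<in>N. v (w x) = u x)"
  using free_basis_if_free_submodule[OF assms(1,2)] free_basis.lift_along[OF _ assms(3-7)] by blast

text \<open>Exactness is demanded in positive degrees only. The resolved module is the cokernel of
  \<open>\<delta> 1\<close> and never appears as an object; statements about it become statements
  about the image of \<open>\<delta> 1\<close>.\<close>

locale acyclic_free_complex = Modules.module scale
  for scale :: "'r::comm_ring_1 \<Rightarrow> 'm::ab_group_add \<Rightarrow> 'm" +
  fixes F :: "nat \<Rightarrow> 'm set" and \<delta> :: "nat \<Rightarrow> 'm \<Rightarrow> 'm"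
  assumes free: "free_submodule scale (F i)"
    and linear: "linear_between scale (F (Suc i)) scale (F i) (\<delta> (Suc i))"
    and exact: "{x \<in> F (Suc i). \<delta> (Suc i) x = 0} = \<delta> (Suc (Suc i)) ` F (Suc (Suc i))"
begin

lemma subspace: "subspace (F i)"
  using free[of i] subspace_span by (metis free_submodule_def)

lemma differential_differential: "x \<in> F (Suc (Suc i)) \<Longrightarrow> \<delta> (Suc i) (\<delta> (Suc (Suc i)) x) = 0"
  using exact[of i] by blast

end

text \<open>The inclusion assumed of \<open>f0\<close> says that it induces a map of the cokernels
  in degree 0. The recursion carries the analogous inclusion along: \<open>f n\<close> sends
  boundaries to boundaries, which is what lifting along \<open>\<gamma> (Suc n)\<close>
  requires.\<close>

lemma comparison_map:
  assumes "acyclic_free_complex s P \<delta>" "acyclic_free_complex t Q \<gamma>"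
    and f0: "linear_between s (P 0) t (Q 0) f0" "f0 ` \<delta> 1 ` P 1 \<subseteq> \<gamma> 1 ` Q 1"
  obtains f where "f 0 = f0" "\<And>i. linear_between s (P i) t (Q i) (f i)"
    "\<And>i x. x \<in> P (Suc i) \<Longrightarrow> \<gamma> (Suc i) (f (Suc i) x) = f i (\<delta> (Suc i) x)"
proof -
  interpret P: acyclic_free_complex s P \<delta> by fact
  interpret Q: acyclic_free_complex t Q \<gamma> by fact
  interpret pair: module_pair s t by unfold_locales
  have "\<exists>f. \<forall>n. (linear_between s (P n) t (Q n) (f n) \<and> (n = 0 \<longrightarrow> f n = f0) \<and>
      f n ` \<delta> (Suc n) ` P (Suc n) \<subseteq> \<gamma> (Suc n) ` Q (Suc n)) \<and>
      (\<forall>x\<in>P (Suc n). \<gamma> (Suc n) (f (Suc n) x) = f n (\<delta> (Suc n) x))"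
  proof (rule dependent_nat_choice)
    show "\<exists>f. linear_between s (P 0) t (Q 0) f \<and> (0 = 0 \<longrightarrow> f = f0) \<and>
        f ` \<delta> (Suc 0) ` P (Suc 0) \<subseteq> \<gamma> (Suc 0) ` Q (Suc 0)"
      using f0 by auto
    fix f n
    assume f: "linear_between s (P n) t (Q n) f \<and> (n = 0 \<longrightarrow> f = f0) \<and>
      f ` \<delta> (Suc n) ` P (Suc n) \<subseteq> \<gamma> (Suc n) ` Q (Suc n)"
    then have lf: "linear_between s (P n) t (Q n) f" by blast
    obtain f' where f': "linear_between s (P (Suc n)) t (Q (Suc n)) f'"
        "\<And>x. x \<in> P (Suc n) \<Longrightarrow> \<gamma> (Suc n) (f' x) = f (\<delta> (Suc n) x)"
      using free_submodule_lift_along[OF P.module_axioms P.free Q.module_axioms Q.subspace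
          linear_between_compose[OF P.linear lf] Q.linear] f
      by (metis image_image)
    have "f' (\<delta> (Suc (Suc n)) y) \<in> \<gamma> (Suc (Suc n)) ` Q (Suc (Suc n))" if y: "y \<in> P (Suc (Suc n))" for y
    proof -
      have "\<delta> (Suc (Suc n)) y \<in> P (Suc n)" using linear_between_mem[OF P.linear y] .
      then show ?thesis
        unfolding Q.exact[symmetric] using f' linear_between_mem[OF f'(1)]
          P.differential_differential[OF y] pair.linear_between_zero[OF lf P.subspace] by simp
    qed
    then show "\<exists>f'. (linear_between s (P (Suc n)) t (Q (Suc n)) f' \<and> (Suc n = 0 \<longrightarrow> f' = f0) \<and>
        f' ` \<delta> (Suc (Suc n)) ` P (Suc (Suc n)) \<subseteq> \<gamma> (Suc (Suc n)) ` Q (Suc (Suc n))) \<and>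
        (\<forall>x\<in>P (Suc n). \<gamma> (Suc n) (f' x) = f (\<delta> (Suc n) x))"
      using f' by (intro exI[of _ f']) auto
  qed
  then show ?thesis using that by metis
qed

text \<open>By \<open>\<phi>0\<close> the chain map \<open>\<phi>\<close> induces zero on the
  cokernel of \<open>\<delta> 1\<close>, so it is null-homotopic,
  \<open>\<phi> = \<delta> h + h \<delta>\<close>, and both terms lie in JF because the differential
  does. It will be applied to composites of comparison maps minus the identity.\<close>

lemma (in acyclic_free_complex) null_homotopic_mem_ideal_times:
  assumes \<phi>: "\<And>i. linear_between scale (F i) scale (F i) (\<phi> i)"
    and comm: "\<And>i x. x \<in> F (Suc i) \<Longrightarrow> \<delta> (Suc i) (\<phi> (Suc i) x) = \<phi> i (\<delta> (Suc i) x)"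
    and \<phi>0: "\<And>x. x \<in> F 0 \<Longrightarrow> \<phi> 0 x \<in> \<delta> 1 ` F 1"
    and min: "\<And>i x. x \<in> F (Suc i) \<Longrightarrow> \<delta> (Suc i) x \<in> ideal_times scale J (F i)"
    and x: "x \<in> F n"
  shows "\<phi> n x \<in> ideal_times scale J (F n)"
proof -
  interpret pair: module_pair scale scale by unfold_locales
  have "\<exists>h. \<forall>n. (linear_between scale (F n) scale (F (Suc n)) (h n) \<and>
      (n = 0 \<longrightarrow> (\<forall>x\<in>F 0. \<phi> 0 x = \<delta> 1 (h n x))) \<and>
      (\<forall>y\<in>F (Suc n). \<phi> (Suc n) y - h n (\<delta> (Suc n) y) \<in> \<delta> (Suc (Suc n)) ` F (Suc (Suc n)))) \<and>
      (\<forall>x\<in>F (Suc n). \<phi> (Suc n) x = \<delta> (Suc (Suc n)) (h (Suc n) x) + h n (\<delta> (Suc n) x))"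
    (is "\<exists>h. \<forall>n. ?P n (h n) \<and> ?Q n (h n) (h (Suc n))")
  proof (rule dependent_nat_choice)
    obtain h where h: "linear_between scale (F 0) scale (F (Suc 0)) h" "\<forall>x\<in>F 0. \<delta> (Suc 0) (h x) = \<phi> 0 x"
      using free_submodule_lift_along[OF module_axioms free module_axioms subspace \<phi> linear] \<phi>0
      by (metis One_nat_def image_subset_iff)
    have "\<phi> (Suc 0) y - h (\<delta> (Suc 0) y) \<in> \<delta> (Suc (Suc 0)) ` F (Suc (Suc 0))" if y: "y \<in> F (Suc 0)" for y
    proof -
      have *: "\<phi> (Suc 0) y \<in> F (Suc 0)" "\<delta> (Suc 0) y \<in> F 0" "h (\<delta> (Suc 0) y) \<in> F (Suc 0)"
        using y linear_between_mem \<phi> linear h(1) by metis+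
      then show ?thesis
        unfolding exact[symmetric] using h(2) y
        by (simp add: pair.linear_between_diff[OF linear subspace] comm subspace_diff[OF subspace])
    qed
    then show "\<exists>h. ?P 0 h" using h by (intro exI[of _ h]) auto
    fix h n assume "?P n h"
    then have h: "linear_between scale (F n) scale (F (Suc n)) h"
      "(\<lambda>y. \<phi> (Suc n) y - h (\<delta> (Suc n) y)) ` F (Suc n) \<subseteq> \<delta> (Suc (Suc n)) ` F (Suc (Suc n))"
      by auto
    obtain h' where h': "linear_between scale (F (Suc n)) scale (F (Suc (Suc n))) h'"
      "\<And>x. x \<in> F (Suc n) \<Longrightarrow> \<delta> (Suc (Suc n)) (h' x) = \<phi> (Suc n) x - h (\<delta> (Suc n) x)"
      using free_submodule_lift_along[OF module_axioms free module_axioms subspace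
          pair.linear_between_diff_fun[OF \<phi> linear_between_compose[OF linear h(1)] subspace] linear h(2)]
      by blast
    have "\<phi> (Suc (Suc n)) y - h' (\<delta> (Suc (Suc n)) y)
        \<in> \<delta> (Suc (Suc (Suc n))) ` F (Suc (Suc (Suc n)))" if y: "y \<in> F (Suc (Suc n))" for y
    proof -
      have *: "\<phi> (Suc (Suc n)) y \<in> F (Suc (Suc n))" "\<delta> (Suc (Suc n)) y \<in> F (Suc n)"
        "h' (\<delta> (Suc (Suc n)) y) \<in> F (Suc (Suc n))"
        using y linear_between_mem \<phi> linear h'(1) by metis+
      then show ?thesis
        unfolding exact[symmetric] using h'(2) y
        by (simp add: pair.linear_between_diff[OF linear subspace] comm subspace_diff[OF subspace]
            differential_differential pair.linear_between_zero[OF h(1) subspace])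
    qed
    then show "\<exists>h'. ?P (Suc n) h' \<and> ?Q n h h'" using h' by (intro exI[of _ h']) auto
  qed
  then obtain h where h: "\<And>n. linear_between scale (F n) scale (F (Suc n)) (h n)"
    "\<And>x. x \<in> F 0 \<Longrightarrow> \<phi> 0 x = \<delta> 1 (h 0 x)"
    "\<And>n x. x \<in> F (Suc n) \<Longrightarrow> \<phi> (Suc n) x = \<delta> (Suc (Suc n)) (h (Suc n) x) + h n (\<delta> (Suc n) x)"
    by metis
  show ?thesis
  proof (cases n)
    case 0
    then show ?thesis using x h(2) min[of "h 0 x" 0] linear_between_mem[OF h(1)] by simp
  next
    case (Suc m)
    have "h m (\<delta> (Suc m) x) \<in> ideal_times scale J (F (Suc m))"
      using min[of x m] x Suc
      by (intro pair.linear_between_image_ideal_times[OF h(1) subspace order_refl linear_between_mem[OF h(1)]])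
        auto
    moreover have "\<delta> (Suc (Suc m)) (h (Suc m) x) \<in> ideal_times scale J (F (Suc m))"
      using min linear_between_mem[OF h(1)] x Suc by blast
    ultimately show ?thesis using h(3) x Suc by (auto intro: subspace_add)
  qed
qed

section \<open>The Koszul complex\<close>

text \<open>
  A subset of the positions of \<open>xs\<close> is encoded as a \<open>bool list\<close>, so a basis element
  \<open>e\<^sub>i\<^sub>1 \<and> \<dots> \<and> e\<^sub>i\<^sub>n\<close> is a list with \<open>n\<close> entries \<open>True\<close>, and a chain is its family of coefficients.
  The recursion is the mapping cone of multiplication by \<open>x\<close>.
\<close>

fun koszul :: "'r::comm_ring_1 list \<Rightarrow> (bool list \<Rightarrow> 'r) \<Rightarrow> bool list \<Rightarrow> 'r" where
  "koszul [] u l = 0"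
| "koszul (x # xs) u [] = 0"
| "koszul (x # xs) u (b # l) =
     (if b then - koszul xs (\<lambda>l. u (True # l)) l
      else koszul xs (\<lambda>l. u (False # l)) l + x * u (True # l))"

definition koszul_chains :: "nat \<Rightarrow> nat \<Rightarrow> (bool list \<Rightarrow> 'r::comm_ring_1) set" where
  "koszul_chains c n = {u. \<forall>l. u l \<noteq> 0 \<longrightarrow> length l = c \<and> count_list l True = n}"

definition koszul_scale :: "'r::comm_ring_1 \<Rightarrow> (bool list \<Rightarrow> 'r) \<Rightarrow> bool list \<Rightarrow> 'r" where
  "koszul_scale r u = (\<lambda>l. r * u l)"

definition koszul_pair :: "(bool list \<Rightarrow> 'r::comm_ring_1) \<Rightarrow> (bool list \<Rightarrow> 'r) \<Rightarrow> bool list \<Rightarrow> 'r" where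
  "koszul_pair v w l = (case l of [] \<Rightarrow> 0 | b # l' \<Rightarrow> if b then w l' else v l')"

text \<open>\<open>replicate c False\<close> encodes the empty subset, the only basis element of
  degree 0, so this identifies the ring with the chains of degree 0.\<close>

definition koszul_const :: "nat \<Rightarrow> 'r::comm_ring_1 \<Rightarrow> bool list \<Rightarrow> 'r" where
  "koszul_const c r l = (if l = replicate c False then r else 0)"

lemma koszul_pair_simps [simp]:
  "koszul_pair v w [] = 0" "koszul_pair v w (b # l) = (if b then w l else v l)"
  by (simp_all add: koszul_pair_def)

lemma module_koszul_scale: "Modules.module koszul_scale"
  by unfold_locales (auto simp: koszul_scale_def algebra_simps)

interpretation koszul: Modules.module "koszul_scale :: 'r::comm_ring_1 \<Rightarrow> _"
  by (fact module_koszul_scale)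

lemma koszul_add: "koszul xs (\<lambda>l. u l + v l) l = koszul xs u l + koszul xs v l"
proof (induction xs u l arbitrary: v rule: koszul.induct)
  case (3 x xs u b l)
  then show ?case by (cases b) (simp_all add: distrib_left add.assoc add.left_commute)
qed auto

lemma koszul_mult: "koszul xs (\<lambda>l. r * u l) l = r * koszul xs u l"
  by (induction xs u l rule: koszul.induct) (auto simp: algebra_simps)

lemma koszul_zero [simp]: "koszul xs (\<lambda>l. 0) l = 0"
  using koszul_mult[of xs 0] by simp

lemma koszul_uminus: "koszul xs (\<lambda>l. - u l) l = - koszul xs u l"
  using koszul_mult[of xs "- 1" u] by simp

lemma koszul_koszul: "koszul xs (koszul xs u) l = 0"
proof (induction xs u l rule: koszul.induct)
  case (3 x xs u b l)
  then show ?case by (cases b) (simp_all add: koszul_add koszul_mult koszul_uminus)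
qed auto

lemma koszul_mem_span: "koszul xs u l \<in> ideal.span (set xs)"
proof (induction xs u l rule: koszul.induct)
  case (3 x xs u b l)
  have mono: "ideal.span (set xs) \<subseteq> ideal.span (set (x # xs))" by (intro ideal.span_mono) auto
  have "x * u (True # l) \<in> ideal.span (set (x # xs))"
    using ideal.span_scale[OF ideal.span_base[of x "set (x # xs)"], of "u (True # l)"]
    by (simp add: mult.commute)
  then show ?case using 3 mono by (auto intro: ideal.span_neg ideal.span_add)
qed (simp_all add: ideal.span_zero)

lemma koszul_chainsD:
  "u \<in> koszul_chains c n \<Longrightarrow> u l \<noteq> 0 \<Longrightarrow> length l = c \<and> count_list l True = n"
  unfolding koszul_chains_def by blast

lemma subspace_koszul_chains: "koszul.subspace (koszul_chains c n)"
proof (rule koszul.subspaceI)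
  show "u + v \<in> koszul_chains c n" if "u \<in> koszul_chains c n" "v \<in> koszul_chains c n" for u v
    unfolding koszul_chains_def mem_Collect_eq
  proof (intro allI impI)
    fix l assume "(u + v) l \<noteq> 0"
    then have "u l \<noteq> 0 \<or> v l \<noteq> 0" by auto
    then show "length l = c \<and> count_list l True = n" using koszul_chainsD that by metis
  qed
  show "koszul_scale r u \<in> koszul_chains c n" if "u \<in> koszul_chains c n" for r u
    unfolding koszul_chains_def mem_Collect_eq koszul_scale_def
    using koszul_chainsD[OF that] by (metis mult_zero_right)
qed (simp add: koszul_chains_def)

lemma koszul_chains_eq_0: "u \<in> koszul_chains c n \<Longrightarrow> length l \<noteq> c \<or> count_list l True \<noteq> n \<Longrightarrow> u l = 0"
  unfolding koszul_chains_def by auto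

lemma koszul_chains_False: "u \<in> koszul_chains (Suc c) n \<Longrightarrow> (\<lambda>l. u (False # l)) \<in> koszul_chains c n"
  unfolding koszul_chains_def by fastforce

lemma koszul_chains_True: "u \<in> koszul_chains (Suc c) (Suc n) \<Longrightarrow> (\<lambda>l. u (True # l)) \<in> koszul_chains c n"
  unfolding koszul_chains_def by fastforce

lemma koszul_pair_mem:
  "v \<in> koszul_chains c (Suc n) \<Longrightarrow> w \<in> koszul_chains c n \<Longrightarrow> koszul_pair v w \<in> koszul_chains (Suc c) (Suc n)"
  unfolding koszul_chains_def by (auto simp: koszul_pair_def split: list.splits)

lemma count_list_eq_0_replicate: "count_list l True = 0 \<Longrightarrow> l = replicate (length l) False"
  by (induction l) (auto split: if_splits)

lemma koszul_const_mem: "koszul_const c r \<in> koszul_chains c 0"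
  unfolding koszul_chains_def koszul_const_def by (auto simp: count_list_0_iff)

lemma koszul_const_Suc [simp]:
  "koszul_const (Suc c) r [] = 0"
  "koszul_const (Suc c) r (b # l) = (if b then 0 else koszul_const c r l)"
  by (auto simp: koszul_const_def)

lemma koszul_const_linear: "koszul_const c (r - k * x) l + x * koszul_const c k l = koszul_const c r l"
  by (simp add: koszul_const_def algebra_simps)

lemma koszul_chains_0_eq: "u \<in> koszul_chains c 0 \<Longrightarrow> u = koszul_const c (u (replicate c False))"
  unfolding koszul_const_def koszul_chains_def
  by (rule ext) (use count_list_eq_0_replicate in force)

lemma koszul_degree_0: "u \<in> koszul_chains (length xs) 0 \<Longrightarrow> koszul xs u l = 0"
proof (induction xs u l rule: koszul.induct)
  case (3 x xs u b l)
  have "u (True # l) = 0" for l using koszul_chainsD[OF 3(3), of "True # l"] by auto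
  then show ?case using 3 koszul_chains_False[of u "length xs" 0] by auto
qed auto

lemma koszul_mem: "u \<in> koszul_chains (length xs) (Suc n) \<Longrightarrow> koszul xs u \<in> koszul_chains (length xs) n"
proof (induction xs arbitrary: u n)
  case Nil
  then show ?case by (auto simp: koszul_chains_def)
next
  case (Cons x xs)
  have F: "koszul xs (\<lambda>l. u (False # l)) \<in> koszul_chains (length xs) n"
    using Cons.IH[OF koszul_chains_False] Cons.prems by simp
  have T: "(\<lambda>l. u (True # l)) \<in> koszul_chains (length xs) n"
    using koszul_chains_True Cons.prems by simp
  show ?case
    unfolding koszul_chains_def mem_Collect_eq
  proof (intro allI impI)
    fix l assume l: "koszul (x # xs) u l \<noteq> 0"
    then obtain b l' where [simp]: "l = b # l'" by (cases l) auto
    show "length l = length (x # xs) \<and> count_list l True = n"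
    proof (cases b)
      case True
      then have l': "koszul xs (\<lambda>l. u (True # l)) l' \<noteq> 0" using l by simp
      then obtain m where m: "n = Suc m" using koszul_degree_0 T by (cases n) blast+
      have "koszul xs (\<lambda>l. u (True # l)) \<in> koszul_chains (length xs) m"
        using Cons.IH T m by blast
      from koszul_chainsD[OF this l'] show ?thesis using True m by simp
    next
      case False
      then have "koszul xs (\<lambda>l. u (False # l)) l' \<noteq> 0 \<or> u (True # l') \<noteq> 0" using l by auto
      then show ?thesis using koszul_chainsD[OF F] koszul_chainsD[OF T] False by auto
    qed
  qed
qed

text \<open>Together with \<open>koszul_mem_span\<close>, this identifies the cokernel of the last
  differential with the ring modulo the ideal of \<open>xs\<close>.\<close>

lemma koszul_const_in_image:
  "r \<in> ideal.span (set xs) \<Longrightarrow> \<exists>v\<in>koszul_chains (length xs) 1. koszul xs v = koszul_const (length xs) r"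
proof (induction xs arbitrary: r)
  case Nil
  then show ?case by (intro bexI[of _ 0]) (auto simp: koszul_const_def koszul_chains_def)
next
  case (Cons x xs)
  then obtain k where "r - k * x \<in> ideal.span (set xs)"
    by (auto simp: ideal.span_insert)
  from Cons.IH[OF this] obtain v where v: "v \<in> koszul_chains (length xs) 1"
    "koszul xs v = koszul_const (length xs) (r - k * x)" by blast
  have "koszul (x # xs) (koszul_pair v (koszul_const (length xs) k)) l
      = koszul_const (length (x # xs)) r l" for l
    using koszul_degree_0[OF koszul_const_mem, of xs k] v(2)
    by (cases l) (auto simp: koszul_const_linear)
  moreover have "koszul_pair v (koszul_const (length xs) k) \<in> koszul_chains (length (x # xs)) 1"
    using koszul_pair_mem[OF _ koszul_const_mem] v(1) by simp
  ultimately show ?case by blast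
qed

text \<open>The recursion of \<^const>\<open>koszul\<close> peels off the head, so the sequence is read from its end.\<close>

primrec regular_rev :: "'r::comm_ring_1 list \<Rightarrow> bool" where
  "regular_rev [] \<longleftrightarrow> True"
| "regular_rev (x # xs) \<longleftrightarrow>
     regular_rev xs \<and> (\<forall>r. x * r \<in> ideal.span (set xs) \<longrightarrow> r \<in> ideal.span (set xs))"

lemma regular_rev_rev:
  assumes "\<forall>i<length xs. \<forall>r. xs ! i * r \<in> ideal.span (set (take i xs)) \<longrightarrow> r \<in> ideal.span (set (take i xs))"
  shows "regular_rev (rev xs)"
  using assms
proof (induction xs rule: rev_induct)
  case (snoc x xs)
  have "\<forall>i<length xs. \<forall>r. xs ! i * r \<in> ideal.span (set (take i xs)) \<longrightarrow> r \<in> ideal.span (set (take i xs))"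
    using snoc.prems by (auto simp: nth_append all_conj_distrib dest: less_SucI)
  then show ?case using snoc.IH snoc.prems[rule_format, of "length xs"] by auto
qed simp

text \<open>This is the long exact sequence of the mapping cone, carried out on elements. The
  \<open>True\<close> part of a cycle is a cycle over the tail; it is a boundary by induction, or in
  degree 0 because \<open>x\<close> is a nonzerodivisor modulo the tail. If it is the boundary of
  \<open>v\<close>, then \<open>uF + x v\<close> is again a cycle and so the boundary of some
  \<open>w\<close>; the pair of \<open>w\<close> and \<open>- v\<close> has boundary
  \<open>u\<close>, the sign coming from the differential of the cone.\<close>

lemma koszul_exact:
  assumes "regular_rev xs" "u \<in> koszul_chains (length xs) (Suc n)" "\<And>l. koszul xs u l = 0"
  shows "\<exists>v\<in>koszul_chains (length xs) (Suc (Suc n)). koszul xs v = u"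
  using assms
proof (induction xs arbitrary: u n)
  case Nil
  then have "u = (\<lambda>l. 0)" by (auto simp: koszul_chains_def fun_eq_iff) 
  then show ?case by (intro bexI[of _ "\<lambda>l. 0"]) (auto simp: koszul_chains_def)
next
  case (Cons x xs)
  define c where "c = length xs"
  define uF uT where "uF = (\<lambda>l. u (False # l))" and "uT = (\<lambda>l. u (True # l))"
  have mem: "uF \<in> koszul_chains c (Suc n)" "uT \<in> koszul_chains c n"
    using koszul_chains_False koszul_chains_True Cons.prems(2) by (auto simp: uF_def uT_def c_def)
  have zero: "koszul xs uT l = 0" "koszul xs uF l + x * uT l = 0" for l
    using Cons.prems(3)[of "True # l"] Cons.prems(3)[of "False # l"] by (simp_all add: uF_def uT_def)
  have "\<exists>v\<in>koszul_chains c (Suc n). koszul xs v = uT"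
  proof (cases n)
    case 0
    define r where "r = uT (replicate c False)"
    have "x * r = - koszul xs uF (replicate c False)"
      using zero(2)[of "replicate c False"] by (simp add: r_def eq_neg_iff_add_eq_0 add.commute)
    then have "x * r \<in> ideal.span (set xs)"
      using koszul_mem_span ideal.span_neg by metis
    then have "r \<in> ideal.span (set xs)" using Cons.prems(1) by simp
    then show ?thesis
      using koszul_const_in_image koszul_chains_0_eq[of uT c] mem(2) 0 unfolding r_def c_def
      by (metis One_nat_def)
  next
    case (Suc m)
    then show ?thesis using Cons.IH[of uT m] Cons.prems(1) mem(2) zero(1) by (simp add: c_def)
  qed
  then obtain v where v: "v \<in> koszul_chains c (Suc n)" "koszul xs v = uT" by blast
  have "(\<lambda>l. uF l + x * v l) \<in> koszul_chains c (Suc n)"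
    using koszul.subspace_add[OF subspace_koszul_chains mem(1)
        koszul.subspace_scale[OF subspace_koszul_chains v(1), of x]]
    by (simp add: koszul_scale_def plus_fun_def)
  moreover have "koszul xs (\<lambda>l. uF l + x * v l) l = 0" for l
    using zero(2) v(2) by (simp add: koszul_add koszul_mult)
  ultimately obtain w where w: "w \<in> koszul_chains c (Suc (Suc n))" "koszul xs w = (\<lambda>l. uF l + x * v l)"
    using Cons.IH[of "\<lambda>l. uF l + x * v l" n] Cons.prems(1) unfolding c_def by auto
  have "koszul_pair w (\<lambda>l. - v l) \<in> koszul_chains (Suc c) (Suc (Suc n))"
    using w(1) v(1) by (intro koszul_pair_mem) (auto simp: koszul_chains_def)
  moreover have "koszul (x # xs) (koszul_pair w (\<lambda>l. - v l)) l = u l" for l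
    using w(2) v(2) koszul_chains_eq_0[OF Cons.prems(2), of "[]"]
    by (cases l) (auto simp: koszul_uminus uF_def uT_def)
  ultimately show ?case by (intro bexI[of _ "koszul_pair w (\<lambda>l. - v l)"]) (auto simp: c_def)
qed

lemma free_basis_koszul_chains:
  "free_basis koszul_scale (koszul_chains c n :: (bool list \<Rightarrow> 'r::comm_ring_1) set)
     {l. length l = c \<and> count_list l True = n} (\<lambda>l l'. if l = l' then 1 else 0) (\<lambda>u. u)"
proof
  have fin: "finite {l::bool list. length l = c \<and> count_list l True = n}"
    using finite_lists_length_eq[of "UNIV::bool set" c] by (rule finite_subset[rotated]) auto
  fix u :: "bool list \<Rightarrow> 'r" assume u: "u \<in> koszul_chains c n"
  let ?I = "{l. l \<in> {l. length l = c \<and> count_list l True = n} \<and> u l \<noteq> 0}"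
  show "finite ?I" using fin by (rule finite_subset[rotated]) auto
  show "u = (\<Sum>l\<in>?I. koszul_scale (u l) (\<lambda>l'. if l = l' then 1 else 0))"
  proof
    fix k
    have "(\<Sum>l\<in>?I. koszul_scale (u l) (\<lambda>l'. if l = l' then 1 else 0)) k = (\<Sum>l\<in>?I. if l = k then u l else 0)"
      using \<open>finite ?I\<close> by (induction rule: finite_induct) (auto simp: koszul_scale_def)
    also have "\<dots> = u k" using \<open>finite ?I\<close> u by (auto simp: koszul_chains_def)
    finally show "u k = (\<Sum>l\<in>?I. koszul_scale (u l) (\<lambda>l'. if l = l' then 1 else 0)) k" by simp
  qed
qed (use subspace_koszul_chains in \<open>auto simp: linear_between_def koszul_scale_def koszul_chains_def\<close>)

lemma acyclic_free_complex_koszul: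
  assumes "regular_rev xs" "(0::'r::comm_ring_1) \<noteq> 1"
  shows "acyclic_free_complex koszul_scale (koszul_chains (length xs)) (\<lambda>_. koszul (xs :: 'r list))"
proof
  show "free_submodule koszul_scale (koszul_chains (length xs) i :: (bool list \<Rightarrow> 'r) set)" for i
    by (rule free_basis.free_submodule[OF free_basis_koszul_chains assms(2)])
  show "linear_between koszul_scale (koszul_chains (length xs) (Suc i)) koszul_scale
      (koszul_chains (length xs) i) (koszul xs)" for i
    using koszul_mem by (auto simp: linear_between_def koszul_scale_def koszul_mult koszul_add
        plus_fun_def fun_eq_iff)
  show "{u \<in> koszul_chains (length xs) (Suc i). koszul xs u = 0} =
      koszul xs ` koszul_chains (length xs) (Suc (Suc i))" for i
  proof (intro equalityI subsetI)
    fix u assume "u \<in> {u \<in> koszul_chains (length xs) (Suc i). koszul xs u = 0}"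
    then have "u \<in> koszul_chains (length xs) (Suc i)" "\<And>l. koszul xs u l = 0" by auto
    from koszul_exact[OF assms(1) this]
    show "u \<in> koszul xs ` koszul_chains (length xs) (Suc (Suc i))" by blast
  next
    fix u assume "u \<in> koszul xs ` koszul_chains (length xs) (Suc (Suc i))"
    then show "u \<in> {u \<in> koszul_chains (length xs) (Suc i). koszul xs u = 0}"
      using koszul_mem koszul_koszul by (auto simp: fun_eq_iff)
  qed
qed

text \<open>This is the usual signed formula for the Koszul differential, recovered from the cone
  recursion. The signs are left open, since the \<open>r i\<close> are only tested for membership in
  an ideal; for positions already in \<open>l\<close> nothing is claimed of
  \<open>r i\<close>.\<close>

lemma koszul_expansion:
  "length l = length xs \<Longrightarrow> \<exists>r. koszul xs u l = (\<Sum>i<length xs. xs ! i * r i) \<and>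
     (\<forall>i<length xs. \<not> l ! i \<longrightarrow> r i = u (l[i := True]) \<or> r i = - u (l[i := True]))"
proof (induction xs u l rule: koszul.induct)
  case (3 x xs u b l)
  show ?case
  proof (cases b)
    case True
    then obtain r where "koszul xs (\<lambda>l. u (True # l)) l = (\<Sum>i<length xs. xs ! i * r i)"
      "\<forall>i<length xs. \<not> l ! i \<longrightarrow> r i = u (True # l[i := True]) \<or> r i = - u (True # l[i := True])"
      using 3 by auto
    with True show ?thesis
      by (intro exI[of _ "case_nat 0 (\<lambda>i. - r i)"])
        (auto simp: sum.lessThan_Suc_shift sum_negf less_Suc_eq_0_disj simp del: sum.lessThan_Suc)
  next
    case False
    then obtain r where "koszul xs (\<lambda>l. u (False # l)) l = (\<Sum>i<length xs. xs ! i * r i)"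
      "\<forall>i<length xs. \<not> l ! i \<longrightarrow> r i = u (False # l[i := True]) \<or> r i = - u (False # l[i := True])"
      using 3 by auto
    with False show ?thesis
      by (intro exI[of _ "case_nat (u (True # l)) r"])
        (auto simp: sum.lessThan_Suc_shift less_Suc_eq_0_disj simp del: sum.lessThan_Suc)
  qed
qed auto

section \<open>Relations among the members of a regular sequence\<close>

lemma span_set_as_sum: "r \<in> ideal.span (set xs) \<Longrightarrow> \<exists>t. r = (\<Sum>i<length xs. xs ! i * t i)"
proof (induction xs arbitrary: r)
  case (Cons x xs)
  then obtain k where "r - k * x \<in> ideal.span (set xs)"
    by (auto simp: ideal.span_insert)
  from Cons.IH[OF this] obtain t where "r - k * x = (\<Sum>i<length xs. xs ! i * t i)" by blast
  then show ?case
    by (intro exI[of _ "case_nat k t"]) (simp add: sum.lessThan_Suc_shift algebra_simps del: sum.lessThan_Suc)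
qed simp

text \<open>Regularity of the head modulo the tail puts \<open>r 0\<close> into the ideal of the
  tail. Expanding it there absorbs \<open>x * r 0\<close> into the other terms and leaves a relation
  among the tail, to which induction applies; its coefficients \<open>r (Suc i) + x * t i\<close>
  differ from \<open>r (Suc i)\<close> by multiples of \<open>x\<close>.\<close>

lemma relation_coefficients_mem_span:
  assumes "regular_rev xs" "(\<Sum>i<length xs. xs ! i * r i) = 0" "i < length xs"
  shows "r i \<in> ideal.span (set xs)"
  using assms
proof (induction xs arbitrary: r i)
  case (Cons x xs)
  have mono: "ideal.span (set xs) \<subseteq> ideal.span (set (x # xs))" by (intro ideal.span_mono) auto
  have sum: "x * r 0 + (\<Sum>i<length xs. xs ! i * r (Suc i)) = 0"
    using Cons.prems(2) by (simp add: sum.lessThan_Suc_shift del: sum.lessThan_Suc)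
  have "(\<Sum>i<length xs. xs ! i * r (Suc i)) \<in> ideal.span (set xs)"
    by (intro ideal.span_sum) (metis ideal.span_base ideal.span_scale lessThan_iff mult.commute nth_mem)
  then have "x * r 0 \<in> ideal.span (set xs)"
    using sum ideal.span_neg by (metis eq_neg_iff_add_eq_0)
  then have r0: "r 0 \<in> ideal.span (set xs)" using Cons.prems(1) by simp
  then obtain t where t: "r 0 = (\<Sum>i<length xs. xs ! i * t i)" using span_set_as_sum by blast
  have "(\<Sum>i<length xs. xs ! i * (r (Suc i) + x * t i)) = 0"
    using sum unfolding t by (simp add: algebra_simps sum.distrib sum_distrib_left)
  then have *: "r (Suc j) + x * t j \<in> ideal.span (set xs)" if "j < length xs" for j
    using Cons.IH[of "\<lambda>i. r (Suc i) + x * t i"] Cons.prems(1) that by simp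
  show ?case
  proof (cases i)
    case 0
    then show ?thesis using r0 mono by auto
  next
    case (Suc j)
    have "t j * x \<in> ideal.span (set (x # xs))"
      by (intro ideal.span_scale ideal.span_base) auto
    then have "r (Suc j) + x * t j - t j * x \<in> ideal.span (set (x # xs))"
      using * Suc Cons.prems(3) mono by (intro ideal.span_diff) auto
    then show ?thesis using Suc by (simp add: algebra_simps)
  qed
qed simp

lemma mem_square_as_sum:
  assumes "p \<in> ideal_times times (ideal.span (set xs)) (ideal.span (set xs))"
  shows "\<exists>t. (\<forall>i. t i \<in> ideal.span (set xs)) \<and> p = (\<Sum>i<length xs. xs ! i * t i)"
proof -
  let ?S = "{p. \<exists>t. (\<forall>i. t i \<in> ideal.span (set xs)) \<and> p = (\<Sum>i<length xs. xs ! i * t i)}"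
  have "ideal_times times (ideal.span (set xs)) (ideal.span (set xs)) \<subseteq> ?S"
  proof (rule ideal.ideal_times_le)
    show "ideal.subspace ?S"
    proof (rule ideal.subspaceI)
      show "0 \<in> ?S" by (auto intro!: exI[of _ "\<lambda>_. 0"] ideal.span_zero)
      show "x + y \<in> ?S" if "x \<in> ?S" "y \<in> ?S" for x y
      proof -
        obtain t t' where "\<And>i. t i \<in> ideal.span (set xs)" "x = (\<Sum>i<length xs. xs ! i * t i)"
          "\<And>i. t' i \<in> ideal.span (set xs)" "y = (\<Sum>i<length xs. xs ! i * t' i)"
          using \<open>x \<in> ?S\<close> \<open>y \<in> ?S\<close> by auto
        then show ?thesis
          by (auto intro!: exI[of _ "\<lambda>i. t i + t' i"] ideal.span_add simp: distrib_left sum.distrib)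
      qed
      show "k * x \<in> ?S" if x: "x \<in> ?S" for k x
      proof -
        obtain t where "\<And>i. t i \<in> ideal.span (set xs)" "x = (\<Sum>i<length xs. xs ! i * t i)"
          using x by auto
        then show ?thesis
          by (auto intro!: exI[of _ "\<lambda>i. k * t i"] ideal.span_scale simp: sum_distrib_left mult.left_commute)
      qed
    qed
    fix a y assume ay: "a \<in> ideal.span (set xs)" "y \<in> ideal.span (set xs)"
    obtain t where "a = (\<Sum>i<length xs. xs ! i * t i)" using span_set_as_sum[OF ay(1)] by blast
    then have "a * y = (\<Sum>i<length xs. xs ! i * (t i * y))"
      by (simp add: sum_distrib_right mult.assoc)
    then show "a * y \<in> ?S"
      using ay(2) by (auto intro!: exI[of _ "\<lambda>i. t i * y"] ideal.span_scale)
  qed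
  then show ?thesis using assms by blast
qed

text \<open>This is the freeness of the conormal module \<open>\<aa>/\<aa>\<^sup>2\<close> over \<open>R/\<aa>\<close>.\<close>

lemma coefficients_mem_span_if_sum_mem_square:
  assumes "regular_rev xs"
    and "(\<Sum>i<length xs. xs ! i * r i) \<in> ideal_times times (ideal.span (set xs)) (ideal.span (set xs))"
    and "i < length xs"
  shows "r i \<in> ideal.span (set xs)"
proof -
  obtain t where t: "\<And>i. t i \<in> ideal.span (set xs)"
    "(\<Sum>i<length xs. xs ! i * r i) = (\<Sum>i<length xs. xs ! i * t i)"
    using mem_square_as_sum[OF assms(2)] by blast
  then have "(\<Sum>i<length xs. xs ! i * (r i - t i)) = 0"
    by (simp add: right_diff_distrib sum_subtractf)
  from relation_coefficients_mem_span[OF assms(1) this assms(3)]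
  have "r i - t i + t i \<in> ideal.span (set xs)" by (intro ideal.span_add t)
  then show ?thesis by simp
qed

text \<open>Positive degree provides an index \<open>i\<close> in \<open>l\<close>. At
  \<open>l\<close> without \<open>i\<close>, the boundary has \<open>u l\<close> up to sign as its
  coefficient of \<open>xs ! i\<close>, so freeness of the conormal module applies.\<close>

lemma koszul_chain_mem_span:
  assumes xs: "regular_rev xs" and u: "u \<in> koszul_chains (length xs) (Suc n)"
    and sq: "\<And>l. koszul xs u l \<in> ideal_times times (ideal.span (set xs)) (ideal.span (set xs))"
  shows "u l \<in> ideal.span (set xs)"
proof (cases "u l = 0")
  case False
  then have l: "length l = length xs" "count_list l True = Suc n"
    using u by (auto simp: koszul_chains_def)
  then have "True \<in> set l" by (metis count_list_0_iff nat.distinct(1))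
  then obtain i where i: "i < length l" "l ! i" by (auto simp: in_set_conv_nth)
  define l' where "l' = l[i := False]"
  have l': "length l' = length xs" "\<not> l' ! i" "l'[i := True] = l"
    using i l(1) by (auto simp: l'_def list_update_same_conv)
  obtain r where r: "koszul xs u l' = (\<Sum>i<length xs. xs ! i * r i)"
    "\<forall>i<length xs. \<not> l' ! i \<longrightarrow> r i = u (l'[i := True]) \<or> r i = - u (l'[i := True])"
    using koszul_expansion[OF l'(1)] by blast
  then have "r i = u l \<or> r i = - u l" using i l(1) l' by auto
  moreover from r(1) have "r i \<in> ideal.span (set xs)"
    using coefficients_mem_span_if_sum_mem_square[OF xs, of r i] sq[of l'] i(1) l(1) by simp
  ultimately show ?thesis using ideal.span_neg by (metis minus_minus)
qed (simp add: ideal.span_zero)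

section \<open>Minimal resolutions of complete intersections\<close>

text \<open>\<open>F 0\<close> need not be the ring itself. The isomorphism of the cokernel of
  \<open>\<delta> 1\<close> with R/\<aa> is represented by its lift \<open>\<epsilon>\<close> to the
  ring and by a preimage \<open>x0\<close> of the class of 1. Minimality is with respect to a proper
  ideal \<open>\<mm>\<close>, a priori unrelated to the ideal of \<open>xs\<close>.\<close>

locale complete_intersection_resolution = acyclic_free_complex scale F \<delta>
  for scale :: "'r::comm_ring_1 \<Rightarrow> 'm::ab_group_add \<Rightarrow> 'm" and F \<delta> +
  fixes \<mm> :: "'r set" and xs :: "'r list" and \<epsilon> :: "'m \<Rightarrow> 'r" and x0 :: 'm
  assumes proper: "ideal.subspace \<mm>" "1 \<notin> \<mm>"
    and minimal: "x \<in> F (Suc i) \<Longrightarrow> \<delta> (Suc i) x \<in> ideal_times scale \<mm> (F i)"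
    and regular: "regular_rev xs"
    and \<epsilon>_linear: "linear_between scale (F 0) times UNIV \<epsilon>"
    and \<epsilon>_kernel: "x \<in> F 0 \<Longrightarrow> \<epsilon> x \<in> ideal.span (set xs) \<longleftrightarrow> x \<in> \<delta> 1 ` F 1"
    and x0: "x0 \<in> F 0" "\<epsilon> x0 - 1 \<in> ideal.span (set xs)"
begin

abbreviation \<aa> :: "'r set" where "\<aa> \<equiv> ideal.span (set xs)"

abbreviation K :: "nat \<Rightarrow> (bool list \<Rightarrow> 'r) set" where "K \<equiv> koszul_chains (length xs)"

sublocale K: acyclic_free_complex koszul_scale K "\<lambda>_. koszul xs"
  using acyclic_free_complex_koszul[OF regular] ideal.subspace_0[OF proper(1)] proper(2) by metis

sublocale to_K: module_pair scale "koszul_scale :: 'r \<Rightarrow> _"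
  by unfold_locales

sublocale endo: module_pair scale scale
  by unfold_locales

sublocale endo_K: module_pair "koszul_scale :: 'r \<Rightarrow> _" koszul_scale
  by unfold_locales

sublocale to_ring: module_pair scale "times :: 'r \<Rightarrow> _"
  by unfold_locales

lemma koszul_chain_mem_ideal_times_iff:
  assumes J: "ideal.subspace J" and u: "u \<in> K n"
  shows "u \<in> ideal_times koszul_scale J (K n) \<longleftrightarrow> (\<forall>l. u l \<in> J)"
proof -
  have "u l \<in> J" if "\<forall>l\<in>{l. length l = length xs \<and> count_list l True = n}. u l \<in> J" for l
    using that koszul_chainsD[OF u, of l] ideal.subspace_0[OF J] by (cases "u l = 0") auto
  then show ?thesis
    using free_basis.mem_ideal_times_iff[OF free_basis_koszul_chains J u] by blast
qed

lemma koszul_mem_ideal_times: "u \<in> K (Suc n) \<Longrightarrow> koszul xs u \<in> ideal_times koszul_scale \<aa> (K n)"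
  using koszul_chain_mem_ideal_times_iff[OF ideal.subspace_span koszul_mem] koszul_mem_span by blast

lemma koszul_reflects_ideal_times:
  assumes u: "u \<in> K (Suc n)"
    and sq: "koszul xs u \<in> ideal_times koszul_scale \<aa> (ideal_times koszul_scale \<aa> (K n))"
  shows "u \<in> ideal_times koszul_scale \<aa> (K (Suc n))"
proof -
  interpret eval: module_pair "koszul_scale :: 'r \<Rightarrow> _" "times :: 'r \<Rightarrow> _"
    by unfold_locales
  have "koszul xs u l \<in> ideal_times times \<aa> \<aa>" for l
  proof (rule eval.linear_between_image_ideal_times[OF _ K.subspace _ _ sq])
    show "linear_between koszul_scale (K n) times UNIV (\<lambda>u. u l)"
      by (auto simp: linear_between_def koszul_scale_def)
    show sub: "ideal_times koszul_scale \<aa> (K n) \<subseteq> K n" by (rule koszul.ideal_times_subset[OF K.subspace])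
    show "v l \<in> \<aa>" if "v \<in> ideal_times koszul_scale \<aa> (K n)" for v
      using koszul_chain_mem_ideal_times_iff[of \<aa> v n] that sub by auto
  qed
  then show ?thesis
    using koszul_chain_mem_span[OF regular u] koszul_chain_mem_ideal_times_iff[OF _ u] by simp
qed

text \<open>
  \<open>F\<close> is minimal with respect to \<open>\<mm>\<close> and the Koszul complex with respect to \<open>\<aa>\<close>, so of the
  two composites of the comparison maps \<open>f\<close> and \<open>g\<close>, one is the identity modulo \<open>\<mm>\<close> and the
  other one modulo \<open>\<aa>\<close>.
\<close>

lemma comparison_with_koszul:
  obtains f where "\<And>i. linear_between scale (F i) koszul_scale (K i) (f i)"
    "\<And>i x. x \<in> F (Suc i) \<Longrightarrow> koszul xs (f (Suc i) x) = f i (\<delta> (Suc i) x)"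
    "\<And>i x. x \<in> F i \<Longrightarrow> f i x \<in> ideal_times koszul_scale \<aa> (K i) \<Longrightarrow> x \<in> ideal_times scale \<aa> (F i)"
proof -
  let ?c = "length xs"
  \<comment> \<open>\<open>f0\<close> and \<open>g0\<close> lift the two mutually inverse
    identifications of the cokernels: \<open>\<epsilon>\<close> followed by the constant chain, and
    the map that sends 1 to \<open>x0\<close>.\<close>
  define f0 where "f0 x = koszul_const ?c (\<epsilon> x)" for x
  define g0 where "g0 u = scale (u (replicate ?c False)) x0" for u
  have const: "koszul_const ?c r \<in> koszul xs ` K 1" if "r \<in> \<aa>" for r
    using koszul_const_in_image[OF that] by (metis imageI)
  have lf0: "linear_between scale (F 0) koszul_scale (K 0) f0"
    unfolding linear_between_def f0_def
    by (auto simp: koszul_const_mem linear_between_add[OF \<epsilon>_linear] linear_between_scale[OF \<epsilon>_linear]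
        koszul_const_def koszul_scale_def fun_eq_iff)
  have lg0: "linear_between koszul_scale (K 0) scale (F 0) g0"
    unfolding linear_between_def g0_def
    by (auto simp: koszul_scale_def scale_left_distrib intro: subspace_scale[OF subspace] x0)
  have f0: "f0 ` \<delta> 1 ` F 1 \<subseteq> koszul xs ` K 1"
  proof
    fix u assume "u \<in> f0 ` \<delta> 1 ` F 1"
    then obtain y where y: "y \<in> F 1" "u = f0 (\<delta> 1 y)" by blast
    then have "\<delta> 1 y \<in> F 0" using linear_between_mem[OF linear[of 0]] by simp
    then have "\<epsilon> (\<delta> 1 y) \<in> \<aa>" using \<epsilon>_kernel y by blast
    then show "u \<in> koszul xs ` K 1" using const y by (simp add: f0_def)
  qed
  have scale_x0: "\<epsilon> (scale r x0) = r * \<epsilon> x0" for r using linear_between_scale[OF \<epsilon>_linear x0(1)] .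
  have mem_x0: "scale r x0 \<in> F 0" for r by (intro subspace_scale[OF subspace] x0)
  have g0: "g0 ` koszul xs ` K 1 \<subseteq> \<delta> 1 ` F 1"
  proof
    fix y assume "y \<in> g0 ` koszul xs ` K 1"
    then obtain u where u: "y = scale (koszul xs u (replicate ?c False)) x0" by (auto simp: g0_def)
    have "\<epsilon> y \<in> \<aa>"
      unfolding u scale_x0 using ideal.span_scale[OF koszul_mem_span] by (metis mult.commute)
    then show "y \<in> \<delta> 1 ` F 1" using \<epsilon>_kernel mem_x0 u by blast
  qed
  obtain f where f: "f 0 = f0" "\<And>i. linear_between scale (F i) koszul_scale (K i) (f i)"
    "\<And>i x. x \<in> F (Suc i) \<Longrightarrow> koszul xs (f (Suc i) x) = f i (\<delta> (Suc i) x)"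
    using comparison_map[OF acyclic_free_complex_axioms K.acyclic_free_complex_axioms lf0 f0] by blast
  obtain g where g: "g 0 = g0" "\<And>i. linear_between koszul_scale (K i) scale (F i) (g i)"
    "\<And>i u. u \<in> K (Suc i) \<Longrightarrow> \<delta> (Suc i) (g (Suc i) u) = g i (koszul xs u)"
    using comparison_map[OF K.acyclic_free_complex_axioms acyclic_free_complex_axioms lg0 g0] by blast
  have gf: "g i (f i x) - x \<in> ideal_times scale \<mm> (F i)" if "x \<in> F i" for i x
  proof (rule null_homotopic_mem_ideal_times[where \<phi> = "\<lambda>i x. g i (f i x) - x", OF _ _ _ minimal that])
    show "linear_between scale (F i) scale (F i) (\<lambda>x. g i (f i x) - x)" for i
      by (rule endo.linear_between_diff_fun[OF linear_between_compose[OF f(2) g(2)]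
            linear_between_ident subspace])
    show "\<delta> (Suc i) (g (Suc i) (f (Suc i) x) - x) = g i (f i (\<delta> (Suc i) x)) - \<delta> (Suc i) x"
      if x: "x \<in> F (Suc i)" for i x
    proof -
      have fx: "f (Suc i) x \<in> K (Suc i)" by (rule linear_between_mem[OF f(2) x])
      show ?thesis
        using endo.linear_between_diff[OF linear subspace linear_between_mem[OF g(2) fx] x]
        by (simp add: g(3)[OF fx] f(3)[OF x])
    qed
    show "g 0 (f 0 x) - x \<in> \<delta> 1 ` F 1" if x: "x \<in> F 0" for x
    proof -
      have "g 0 (f 0 x) - x = scale (\<epsilon> x) x0 - x"
        by (simp add: f(1) g(1) f0_def g0_def koszul_const_def)
      \<comment> \<open>The error lies in \<aa> because \<open>\<epsilon> x0\<close> is 1 modulo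
        \<aa>, and \<open>\<epsilon>_kernel\<close> turns this into a boundary.\<close>
      moreover have "\<epsilon> (scale (\<epsilon> x) x0 - x) = \<epsilon> x * (\<epsilon> x0 - 1)"
        using to_ring.linear_between_diff[OF \<epsilon>_linear subspace mem_x0 x]
        by (simp add: scale_x0 right_diff_distrib)
      ultimately show ?thesis
        using \<epsilon>_kernel[of "scale (\<epsilon> x) x0 - x"] subspace_diff[OF subspace mem_x0 x]
          ideal.span_scale[OF x0(2)] by simp
    qed
  qed
  have fg: "f i (g i u) - u \<in> ideal_times koszul_scale \<aa> (K i)" if "u \<in> K i" for i u
  proof (rule K.null_homotopic_mem_ideal_times[where \<phi> = "\<lambda>i u. f i (g i u) - u",
        OF _ _ _ koszul_mem_ideal_times that])
    show "linear_between koszul_scale (K i) koszul_scale (K i) (\<lambda>u. f i (g i u) - u)" for i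
      by (rule endo_K.linear_between_diff_fun[OF linear_between_compose[OF g(2) f(2)]
            linear_between_ident K.subspace])
    show "koszul xs (f (Suc i) (g (Suc i) u) - u) = f i (g i (koszul xs u)) - koszul xs u"
      if u: "u \<in> K (Suc i)" for i u
    proof -
      have gu: "g (Suc i) u \<in> F (Suc i)" by (rule linear_between_mem[OF g(2) u])
      show ?thesis
        using endo_K.linear_between_diff[OF K.linear K.subspace linear_between_mem[OF f(2) gu] u]
        by (simp add: f(3)[OF gu] g(3)[OF u])
    qed
    show "f 0 (g 0 u) - u \<in> koszul xs ` K 1" if u: "u \<in> K 0" for u
    proof -
      define r where "r = u (replicate ?c False)"
      have "f 0 (g 0 u) - u = koszul_const ?c (r * (\<epsilon> x0 - 1))"
        using koszul_chains_0_eq[OF u] unfolding r_def[symmetric]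
        by (auto simp: f(1) g(1) f0_def g0_def scale_x0 r_def[symmetric] koszul_const_def
            fun_eq_iff algebra_simps)
      then show ?thesis using const[OF ideal.span_scale[OF x0(2)]] by simp
    qed
  qed
  have "x \<in> ideal_times scale \<aa> (F i)"
    if x: "x \<in> F i" "f i x \<in> ideal_times koszul_scale \<aa> (K i)" for i x
  proof -
    obtain B where B: "free_basis scale (F i) B (\<lambda>b. b) (representation B)"
      using free_basis_if_free_submodule[OF module_axioms free] by blast
    have "finite {l::bool list. length l = ?c \<and> count_list l True = i}"
      using finite_lists_length_eq[of "UNIV::bool set" ?c] by (rule finite_subset[rotated]) auto
    from mem_ideal_times_if_image_mem[OF B free_basis_koszul_chains this f(2) g(2) proper
        ideal.subspace_span gf fg x]
    show ?thesis .
  qed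
  then show ?thesis using that[OF f(2,3)] by blast
qed

text \<open>The comparison map turns \<open>\<delta>\<close> into the Koszul differential, whose
  values have coefficients in \<aa>, and it reflects membership in \<aa>F.\<close>

lemma differential_mem_ideal_times:
  assumes "x \<in> F (Suc i)"
  shows "\<delta> (Suc i) x \<in> ideal_times scale \<aa> (F i)"
proof (rule comparison_with_koszul)
  fix f assume f: "\<And>i. linear_between scale (F i) koszul_scale (K i) (f i)"
    "\<And>i x. x \<in> F (Suc i) \<Longrightarrow> koszul xs (f (Suc i) x) = f i (\<delta> (Suc i) x)"
    "\<And>i x. x \<in> F i \<Longrightarrow> f i x \<in> ideal_times koszul_scale \<aa> (K i) \<Longrightarrow> x \<in> ideal_times scale \<aa> (F i)"
  show ?thesis
    using koszul_mem_ideal_times[OF linear_between_mem[OF f(1) assms]] f(2)[OF assms]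
      f(3)[OF linear_between_mem[OF linear assms]] by simp
qed

text \<open>Again the question is moved to the Koszul complex. Linearity alone carries \<aa>\<aa>F
  into \<aa>\<aa>K; only the conclusion has to be brought back.\<close>

lemma differential_reflects_ideal_times:
  assumes x: "x \<in> F (Suc i)"
    and sq: "\<delta> (Suc i) x \<in> ideal_times scale \<aa> (ideal_times scale \<aa> (F i))"
  shows "x \<in> ideal_times scale \<aa> (F (Suc i))"
proof (rule comparison_with_koszul)
  fix f assume f: "\<And>i. linear_between scale (F i) koszul_scale (K i) (f i)"
    "\<And>i x. x \<in> F (Suc i) \<Longrightarrow> koszul xs (f (Suc i) x) = f i (\<delta> (Suc i) x)"
    "\<And>i x. x \<in> F i \<Longrightarrow> f i x \<in> ideal_times koszul_scale \<aa> (K i) \<Longrightarrow> x \<in> ideal_times scale \<aa> (F i)"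
  have "f i (\<delta> (Suc i) x) \<in> ideal_times koszul_scale \<aa> (ideal_times koszul_scale \<aa> (K i))"
    by (rule to_K.linear_between_image_ideal_times[OF f(1) subspace ideal_times_subset[OF subspace]
          to_K.linear_between_image_ideal_times[OF f(1) subspace order_refl linear_between_mem[OF f(1)]]
          sq])
  then show ?thesis
    using koszul_reflects_ideal_times[OF linear_between_mem[OF f(1) x]] f(2)[OF x] f(3)[OF x] by simp
qed

end

section \<open>Internal direct sums and free flags\<close>

locale module_direct_sum = Modules.module scale
  for scale :: "'r::comm_ring_1 \<Rightarrow> 'm::ab_group_add \<Rightarrow> 'm" +
  fixes F :: "nat \<Rightarrow> 'm set"
  assumes direct: "internal_direct_sum F" and summand: "subspace (F i)"
begin

lemma component_eq: "decomposes F x c \<Longrightarrow> component F i x = c i"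
  using direct unfolding internal_direct_sum_def component_def by (metis the1_equality)

lemma decomposes_component: "decomposes F x (\<lambda>i. component F i x)"
proof -
  obtain c where "decomposes F x c" using direct unfolding internal_direct_sum_def by blast
  moreover from this have "(\<lambda>i. component F i x) = c" using component_eq by auto
  ultimately show ?thesis by simp
qed

lemma component_mem: "component F i x \<in> F i"
  and finite_components: "finite {i. component F i x \<noteq> 0}"
  and sum_components: "(\<Sum>i | component F i x \<noteq> 0. component F i x) = x"
  using decomposes_component[of x] unfolding decomposes_def by simp_all

lemma component_eqI:
  assumes "\<And>i. c i \<in> F i" "finite S" "\<And>i. i \<notin> S \<Longrightarrow> c i = 0" "x = (\<Sum>i\<in>S. c i)"
  shows "component F i x = c i"
proof (rule component_eq)
  have "(\<Sum>i | c i \<noteq> 0. c i) = (\<Sum>i\<in>S. c i)"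
    using assms(2,3) by (intro sum.mono_neutral_left) auto
  moreover have "finite {i. c i \<noteq> 0}" using assms(2,3) by (metis (mono_tags) finite_subset mem_Collect_eq subsetI)
  ultimately show "decomposes F x c" using assms by (simp add: decomposes_def)
qed

lemma sum_components_superset:
  assumes "finite S" "{i. component F i x \<noteq> 0} \<subseteq> S"
  shows "x = (\<Sum>i\<in>S. component F i x)"
proof -
  have "(\<Sum>i | component F i x \<noteq> 0. component F i x) = (\<Sum>i\<in>S. component F i x)"
    using assms by (intro sum.mono_neutral_left) auto
  then show ?thesis by (simp add: sum_components)
qed

lemma component_of_summand: "x \<in> F j \<Longrightarrow> component F i x = (if i = j then x else 0)"
  using subspace_0[OF summand] by (intro component_eqI[of _ "{j}"]) auto

lemma module_hom_component: "module_hom scale scale (component F i)"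
proof
  show "component F i (x + y) = component F i x + component F i y" for x y
    using subspace_add[OF summand component_mem component_mem] finite_components[of x] finite_components[of y]
      sum_components_superset[of "{i. component F i x \<noteq> 0} \<union> {i. component F i y \<noteq> 0}"]
    by (intro component_eqI[of _ "{i. component F i x \<noteq> 0} \<union> {i. component F i y \<noteq> 0}"])
      (auto simp: sum.distrib)
  show "component F i (scale r x) = scale r (component F i x)" for r x
    using subspace_scale[OF summand component_mem] finite_components[of x] sum_components[of x]
    by (intro component_eqI[of _ "{i. component F i x \<noteq> 0}"]) (auto simp: scale_sum_right[symmetric])
qed

sublocale component: module_hom scale scale "component F i" for i
  by (fact module_hom_component)

lemma component_zero [simp]: "component F i 0 = 0"
  by (rule component.zero)

lemma eq_0_if_components: "(\<And>i. component F i x = 0) \<Longrightarrow> x = 0"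
  using sum_components[of x] by simp

text \<open>This is the flag filtration, the sum of all \<open>F i\<close> with
  \<open>i < n\<close>. Vanishing components make top components accessible, and
  \<open>below 0\<close> is the zero module, where inductions along the flag start.\<close>

definition below :: "nat \<Rightarrow> 'm set" where
  "below n = {x. \<forall>i\<ge>n. component F i x = 0}"

lemma subspace_below: "subspace (below n)"
  by (rule subspaceI) (auto simp: below_def component.add component.scale)

lemma below_mono: "m \<le> n \<Longrightarrow> x \<in> below m \<Longrightarrow> x \<in> below n"
  by (auto simp: below_def)

lemma below_0: "x \<in> below 0 \<longleftrightarrow> x = 0"
  using eq_0_if_components by (auto simp: below_def)

lemma summand_below: "i < n \<Longrightarrow> x \<in> F i \<Longrightarrow> x \<in> below n"
  by (auto simp: below_def component_of_summand)

lemma ex_below: "\<exists>n. x \<in> below n"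
proof -
  obtain n where "\<forall>i\<in>{i. component F i x \<noteq> 0}. i < n"
    using finite_components[of x] finite_nat_set_iff_bounded by blast
  then have "x \<in> below n" by (force simp: below_def)
  then show ?thesis ..
qed

lemma sum_components_below: "x \<in> below n \<Longrightarrow> x = (\<Sum>i<n. component F i x)"
  by (intro sum_components_superset) (auto simp: below_def not_less[symmetric])

lemma below_Suc_iff: "x \<in> below (Suc n) \<longleftrightarrow> x - component F n x \<in> below n"
proof -
  have "component F i (x - component F n x) = (if i = n then 0 else component F i x)" for i
    by (simp add: component.diff component_of_summand[OF component_mem])
  then show ?thesis by (auto simp: below_def Suc_le_eq less_le)
qed

lemma below_if_top_eq_0: "x \<in> below (Suc n) \<Longrightarrow> component F n x = 0 \<Longrightarrow> x \<in> below n"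
  by (simp add: below_Suc_iff)

lemma below_subset:
  assumes "subspace T" "\<And>i. i < n \<Longrightarrow> F i \<subseteq> T"
  shows "below n \<subseteq> T"
proof
  fix x assume "x \<in> below n"
  then have "x = (\<Sum>i<n. component F i x)" by (rule sum_components_below)
  also have "\<dots> \<in> T" using assms component_mem by (intro subspace_sum) auto
  finally show "x \<in> T" .
qed

lemma span_summands_subset_below: "span (\<Union>j<n. F j) \<subseteq> below n"
  using summand_below by (intro span_minimal subspace_below) auto

end

locale anchored_flag = module_direct_sum scale F + acyclic_free_complex scale F \<delta>
  for scale :: "'r::comm_ring_1 \<Rightarrow> 'm::ab_group_add \<Rightarrow> 'm" and F \<delta> +
  fixes d :: "'m \<Rightarrow> 'm"
  assumes d_hom: "module_hom scale scale d"
    and d_d [simp]: "d (d x) = 0"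
    and d_flag: "x \<in> F i \<Longrightarrow> d x \<in> below i"
    and anchored: "x \<in> F (Suc i) \<Longrightarrow> component F i (d x) = \<delta> (Suc i) x"
begin

sublocale d: module_hom scale scale d by (fact d_hom)

sublocale pair: module_pair scale scale by unfold_locales

abbreviation D :: "'m \<Rightarrow> 'm" where "D \<equiv> fold_differential F \<delta>"

lemma \<delta>_zero [simp]: "\<delta> (Suc i) 0 = 0"
  by (rule pair.linear_between_zero[OF linear subspace])

lemma subspace_boundaries: "subspace (\<delta> (Suc i) ` F (Suc i))"
proof (rule subspaceI)
  show "0 \<in> \<delta> (Suc i) ` F (Suc i)"
    using subspace_0[OF subspace] \<delta>_zero by (metis image_eqI)
  show "x + y \<in> \<delta> (Suc i) ` F (Suc i)" if "x \<in> \<delta> (Suc i) ` F (Suc i)" "y \<in> \<delta> (Suc i) ` F (Suc i)" for x y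
    using that subspace_add[OF subspace] by (auto simp flip: linear_between_add[OF linear])
  show "scale c x \<in> \<delta> (Suc i) ` F (Suc i)" if "x \<in> \<delta> (Suc i) ` F (Suc i)" for c x
    using that subspace_scale[OF subspace] by (auto simp flip: linear_between_scale[OF linear])
qed

section \<open>The fold as a differential module\<close>

lemma component_fold: "component F i (D x) = \<delta> (Suc i) (component F (Suc i) x)"
proof -
  let ?S = "{i. component F (Suc i) x \<noteq> 0}"
  have "finite (Suc -` {i. component F i x \<noteq> 0})"
    by (intro finite_vimageI finite_components) auto
  then have S: "finite ?S" by (simp add: vimage_def)
  have "{i. i \<ge> 1 \<and> component F i x \<noteq> 0} = Suc ` ?S"
    by (auto simp: image_iff Suc_le_eq gr0_conv_Suc)
  then have "D x = (\<Sum>i\<in>Suc ` ?S. \<delta> i (component F i x))" by (simp add: fold_differential_def)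
  also have "\<dots> = (\<Sum>i\<in>?S. \<delta> (Suc i) (component F (Suc i) x))"
    by (subst sum.reindex) auto
  finally show ?thesis
    using S by (intro component_eqI[of _ ?S] linear_between_mem[OF linear component_mem]) auto
qed

lemma D_hom: "module_hom scale scale D"
proof
  have eqI: "x = y" if "\<And>i. component F i x = component F i y" for x y
    using eq_0_if_components[of "x - y"] that by (simp add: component.diff)
  show "D (x + y) = D x + D y" for x y
    by (rule eqI) (simp add: component.add component_fold linear_between_add[OF linear component_mem component_mem])
  show "D (scale r x) = scale r (D x)" for r x
    by (rule eqI) (simp add: component.scale component_fold linear_between_scale[OF linear component_mem])
qed

sublocale D: module_hom scale scale D by (fact D_hom)

lemma D_D [simp]: "D (D x) = 0"
  by (rule eq_0_if_components) (simp add: component_fold differential_differential component_mem)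

lemma D_below: "x \<in> below (Suc n) \<Longrightarrow> D x \<in> below n"
  by (simp add: below_def component_fold)

lemma d_below: "x \<in> below (Suc n) \<Longrightarrow> d x \<in> below n"
proof -
  have "below (Suc n) \<subseteq> {x. d x \<in> below n}"
    using d_flag below_mono
    by (intro below_subset d.subspace_linear_preimage subspace_below) (auto simp: less_Suc_eq_le)
  then show "x \<in> below (Suc n) \<Longrightarrow> d x \<in> below n" by auto
qed

lemma d_below': "x \<in> below n \<Longrightarrow> d x \<in> below n"
  using d_below below_mono[of n "Suc n"] by simp

lemma d_0: "x \<in> F 0 \<Longrightarrow> d x = 0"
  using d_flag[of x 0] by (simp add: below_0)

text \<open>This is injectivity of the map from the cokernel of \<open>\<delta> 1\<close> to H(D).
  The element \<open>y\<close> is not a cycle, but above degree 1 its top component \<open>z\<close>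
  is a cycle of the resolution, because d y has no component in the degree directly below. So
  \<open>z\<close> is a boundary \<open>\<delta> w\<close>, and passing to \<open>y - d w\<close>
  lowers the degree without changing d y.\<close>

lemma d_in_summand_0:
  assumes "d y \<in> F 0"
  shows "d y \<in> \<delta> 1 ` F 1"
proof -
  have "d y \<in> \<delta> (Suc 0) ` F (Suc 0)" if "y \<in> below n" "d y \<in> F 0" for n y
    using that
  proof (induction n arbitrary: y)
    case 0
    then show ?case using subspace_0[OF subspace_boundaries] by (simp add: below_0)
  next
    case (Suc n)
    define z where "z = component F n y"
    have z: "z \<in> F n" "y - z \<in> below n" using Suc.prems(1) component_mem by (auto simp: z_def below_Suc_iff)
    show ?case
    proof (cases n)
      case 0
      then have "y \<in> F 0" using z by (simp add: below_0)
      then show ?thesis using d_0 subspace_0[OF subspace_boundaries] by simp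
    next
      case (Suc m)
      have "d y = d (y - z) + d z" by (simp add: d.diff)
      moreover have "d (y - z) \<in> below m" using z(2) Suc d_below by simp
      ultimately have top: "component F m (d y) = \<delta> (Suc m) z"
        using anchored[of z m] z(1) Suc by (simp add: component.add below_def)
      show ?thesis
      proof (cases m)
        case 0
        have "component F 0 (d y) = d y" using component_of_summand[OF Suc.prems(2)] by simp
        then show ?thesis using top 0 z(1) \<open>n = Suc m\<close> by auto
      next
        case (Suc k)
        then have "\<delta> (Suc m) z = 0" using top component_of_summand[OF Suc.prems(2), of m] by simp
        then obtain w where w: "w \<in> F (Suc n)" "z = \<delta> (Suc n) w"
          using exact[of m] z(1) \<open>n = Suc m\<close> by blast
        have "y - d w \<in> below (Suc n)"
          using Suc.prems(1) d_flag[OF w(1)] by (intro subspace_diff subspace_below)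
        moreover have "component F n (y - d w) = 0"
          using anchored[OF w(1)] w(2) by (simp add: component.diff z_def)
        ultimately have "y - d w \<in> below n" by (rule below_if_top_eq_0)
        from Suc.IH[OF this] show ?thesis using Suc.prems(2) by (simp add: d.diff)
      qed
    qed
  qed
  then show ?thesis using ex_below assms by fastforce
qed

section \<open>Construction of an isomorphism with the fold\<close>

text \<open>In the fold the cycle condition splits into degrees, so exactness applies to each
  component separately, and only degree 0 needs the extra hypothesis. The primitive is shifted up by
  one degree, hence has no component in \<open>F 0\<close>; this permits its use as a
  correction.\<close>

lemma fold_cycle_is_boundary:
  assumes z: "z \<in> below m" "D z = 0" "component F 0 z \<in> \<delta> 1 ` F 1"
  shows "\<exists>y\<in>below (Suc m). component F 0 y = 0 \<and> D y = z"
proof -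
  have "component F i z \<in> \<delta> (Suc i) ` F (Suc i)" for i
  proof (cases i)
    case 0
    then show ?thesis using z(3) by simp
  next
    case (Suc j)
    then have "\<delta> (Suc j) (component F (Suc j) z) = 0" using component_fold[of j z] z(2) by simp
    then show ?thesis using exact[of j] component_mem[of "Suc j" z] Suc by blast
  qed
  then have "\<exists>w. w \<in> F (Suc i) \<and> \<delta> (Suc i) w = component F i z" for i by (metis image_iff)
  then obtain w where w: "\<And>i. w i \<in> F (Suc i)" "\<And>i. \<delta> (Suc i) (w i) = component F i z"
    by metis
  define y where "y = (\<Sum>i<m. w i)"
  have "component F 0 (w i) = 0" for i using component_of_summand[OF w(1)] by simp
  moreover have "y \<in> below (Suc m)"
    unfolding y_def using summand_below[OF _ w(1)] by (intro subspace_sum subspace_below) auto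
  moreover have "D y = z"
  proof -
    have "D (w i) = component F i z" for i
    proof -
      have "component F j (D (w i)) = component F j (component F i z)" for j
        by (simp add: component_fold component_of_summand[OF w(1)] w(2)
            component_of_summand[OF component_mem])
      then show ?thesis
        using eq_0_if_components[of "D (w i) - component F i z"] by (simp add: component.diff)
    qed
    then show ?thesis using sum_components_below[OF z(1)] by (simp add: y_def D.sum)
  qed
  ultimately show ?thesis by (intro bexI[of _ y]) (simp_all add: y_def component.sum)
qed

text \<open>
  Preserving the component in \<open>F 0\<close> is what makes the obstruction to the next step a boundary.
\<close>

definition partial_fold_map :: "nat \<Rightarrow> ('m \<Rightarrow> 'm) \<Rightarrow> bool" where
  "partial_fold_map n \<phi> \<longleftrightarrow> module_hom scale scale \<phi> \<and>
     (\<forall>i. \<forall>x\<in>F i. \<phi> x - x \<in> below i \<and> component F 0 (\<phi> x) = component F 0 x) \<and>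
     (\<forall>x\<in>below n. D (\<phi> x) = \<phi> (d x))"

lemma partial_fold_map_triangular:
  assumes "partial_fold_map n \<phi>" "x \<in> below (Suc k)"
  shows "\<phi> x - x \<in> below k" and "component F 0 (\<phi> x) = component F 0 x"
proof -
  have hom: "module_hom scale scale (\<lambda>x. \<phi> x - x)"
    using assms(1) unfolding partial_fold_map_def
    by (intro pair.module_hom_sub module_hom_ident) auto
  interpret diff: module_hom scale scale "\<lambda>x. \<phi> x - x" by (fact hom)
  have "below (Suc k) \<subseteq> {x. \<phi> x - x \<in> below k}"
    using assms(1) below_mono unfolding partial_fold_map_def
    by (intro below_subset diff.subspace_linear_preimage subspace_below)
      (auto simp: less_Suc_eq_le)
  then show "\<phi> x - x \<in> below k" using assms(2) by auto
  have "subspace {x. component F 0 x = 0}" by (rule component.subspace_kernel)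
  then have "below (Suc k) \<subseteq> {x. \<phi> x - x \<in> {x. component F 0 x = 0}}"
    using assms(1) unfolding partial_fold_map_def
    by (intro below_subset diff.subspace_linear_preimage) (auto simp: component.diff)
  then show "component F 0 (\<phi> x) = component F 0 x" using assms(2) by (auto simp: component.diff)
qed

text \<open>The new map adds on \<open>F n\<close> a solution \<open>w\<close> of
  \<open>D (w x) = u x\<close>. Anchoring is what lowers the degree of \<open>u x\<close>: both
  \<open>\<phi> (d x)\<close> and \<open>D (\<phi> x)\<close> have the component
  \<open>\<delta> n x\<close> in the degree below \<open>n\<close>. This keeps the new map
  triangular, and freeness of \<open>F n\<close> lets \<open>w\<close> be linear.\<close>

lemma partial_fold_map_step:
  assumes A0: "\<And>x i. x \<in> F i \<Longrightarrow> component F 0 (d x) \<in> \<delta> 1 ` F 1"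
    and \<phi>: "partial_fold_map n \<phi>"
  shows "\<exists>\<psi>. partial_fold_map (Suc n) \<psi> \<and> (\<forall>x\<in>below n. \<psi> x = \<phi> x)"
proof -
  interpret \<phi>: module_hom scale scale \<phi> using \<phi> by (simp add: partial_fold_map_def)
  have tri: "\<And>x i. x \<in> F i \<Longrightarrow> \<phi> x - x \<in> below i"
    "\<And>x i. x \<in> F i \<Longrightarrow> component F 0 (\<phi> x) = component F 0 x"
    and comm: "\<And>x. x \<in> below n \<Longrightarrow> D (\<phi> x) = \<phi> (d x)"
    using \<phi> unfolding partial_fold_map_def by blast+
  define u where "u x = \<phi> (d x) - D (\<phi> x)" for x
  \<comment> \<open>Corrections from \<open>W\<close> change neither the leading term on
    \<open>F n\<close> nor the component in \<open>F 0\<close>.\<close>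
  define W where "W = {y \<in> below n. component F 0 y = 0}"
  have W: "subspace W"
    unfolding W_def by (rule subspaceI) (auto simp: component.add component.scale
        intro: subspace_0 subspace_add subspace_scale subspace_below)
  have u_hom: "module_hom scale scale u"
    unfolding u_def using pair.module_hom_sub[OF module_hom_compose[OF d_hom \<phi>.module_hom_axioms]
        module_hom_compose[OF \<phi>.module_hom_axioms D_hom]] by (simp add: o_def)
  have "u x \<in> D ` W" if x: "x \<in> F n" for x
  proof (cases n)
    case 0
    have "\<phi> x = x" using tri(1)[OF x] 0 by (simp add: below_0)
    moreover have "D x = 0"
      by (rule eq_0_if_components) (use component_of_summand[OF x] 0 in \<open>simp add: component_fold\<close>)
    ultimately have "u x = 0" using d_0 x 0 by (simp add: u_def \<phi>.zero)
    then show ?thesis using subspace_0[OF W] D.zero by (metis image_eqI)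
  next
    case (Suc m)
    have dx: "d x \<in> below (Suc m)" using d_flag[OF x] Suc by simp
    have "u x \<in> below m"
    proof (rule below_if_top_eq_0)
      have \<phi>x: "\<phi> x - x + x \<in> below (Suc n)"
        using tri(1)[OF x] below_mono[of n "Suc n"] summand_below[OF _ x, of "Suc n"]
        by (intro subspace_add[OF subspace_below]) auto
      have \<phi>dx: "\<phi> (d x) - d x \<in> below m" by (rule partial_fold_map_triangular(1)[OF \<phi> dx])
      have "\<phi> (d x) - d x + d x \<in> below (Suc m)"
        using dx \<phi>dx below_mono[of m "Suc m"] by (intro subspace_add[OF subspace_below]) auto
      then show "u x \<in> below (Suc m)"
        unfolding u_def using D_below[OF \<phi>x] Suc by (intro subspace_diff[OF subspace_below]) auto
      have "component F m (\<phi> (d x)) = component F m (d x)"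
        using \<phi>dx by (auto simp: below_def component.diff)
      moreover have "component F n (\<phi> x) = x"
        using tri(1)[OF x] component_of_summand[OF x, of n] by (auto simp: below_def component.diff)
      ultimately show "component F m (u x) = 0"
        using anchored[of x m] x Suc by (simp add: u_def component.diff component_fold)
    qed
    moreover have "D (u x) = 0"
      using comm[of "d x"] dx Suc by (simp add: u_def D.diff \<phi>.zero)
    moreover have "component F 0 (u x) \<in> \<delta> 1 ` F 1"
    proof -
      \<comment> \<open>Since \<open>\<phi>\<close> preserves components in \<open>F 0\<close>, the
        value of \<open>A_{n,0}\<close> survives, up to an element of the image of
        \<open>\<delta> 1\<close>.\<close>
      have "component F 0 (u x) = component F 0 (d x) - \<delta> (Suc 0) (component F (Suc 0) (\<phi> x))"
        using partial_fold_map_triangular(2)[OF \<phi> dx] by (simp add: u_def component.diff component_fold)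
      then show ?thesis
        using A0[OF x] subspace_diff[OF subspace_boundaries[of 0]] component_mem[of "Suc 0" "\<phi> x"] by simp
    qed
    ultimately show ?thesis
      using fold_cycle_is_boundary[of "u x" m] Suc unfolding W_def by (simp add: image_iff) metis
  qed
  then obtain w where w: "linear_between scale (F n) scale W w" "\<And>x. x \<in> F n \<Longrightarrow> D (w x) = u x"
    using free_submodule_lift_along[OF module_axioms free module_axioms W
        linear_between_if_module_hom[OF u_hom, of "F n" UNIV]
        linear_between_if_module_hom[OF D_hom, of W UNIV]] by blast
  define \<psi> where "\<psi> x = \<phi> x + w (component F n x)" for x
  have w0: "w 0 = 0" by (rule pair.linear_between_zero[OF w(1) subspace])
  have hom: "module_hom scale scale \<psi>"
    by unfold_locales (simp_all add: \<psi>_def \<phi>.add \<phi>.scale component.add component.scale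
        linear_between_add[OF w(1) component_mem component_mem]
        linear_between_scale[OF w(1) component_mem] scale_right_distrib)
  interpret \<psi>: module_hom scale scale \<psi> by (fact hom)
  have \<psi>_eq: "\<psi> x = \<phi> x" if "x \<in> below n" for x
    using that by (simp add: \<psi>_def below_def w0)
  have "\<psi> x - x \<in> below i \<and> component F 0 (\<psi> x) = component F 0 x" if x: "x \<in> F i" for x i
  proof (cases "i = n")
    case True
    then have wx: "w x \<in> below n" "component F 0 (w x) = 0"
      using linear_between_mem[OF w(1)] x by (auto simp: W_def)
    have "\<psi> x = \<phi> x + w x" using component_of_summand[OF x] True by (simp add: \<psi>_def)
    then show ?thesis
      using tri[OF x] wx True subspace_add[OF subspace_below, of "\<phi> x - x" n "w x"]
      by (simp add: component.add algebra_simps)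
  next
    case False
    then have "\<psi> x = \<phi> x" using component_of_summand[OF x] by (simp add: \<psi>_def w0)
    then show ?thesis using tri[OF x] by simp
  qed
  moreover have "D (\<psi> x) = \<psi> (d x)" if x: "x \<in> below (Suc n)" for x
  proof -
    define y where "y = component F n x"
    have y: "y \<in> F n" "x - y \<in> below n" using x component_mem by (auto simp: y_def below_Suc_iff)
    have "D (\<psi> (x - y)) = \<psi> (d (x - y))"
      using \<psi>_eq[OF y(2)] \<psi>_eq[OF d_below'[OF y(2)]] comm[OF y(2)] by simp
    moreover have "D (\<psi> y) = \<psi> (d y)"
      using \<psi>_eq[OF d_flag[OF y(1)]] component_of_summand[OF y(1)] w(2)[OF y(1)]
      by (simp add: \<psi>_def D.add u_def)
    ultimately have "D (\<psi> (x - y)) + D (\<psi> y) = \<psi> (d (x - y)) + \<psi> (d y)" by simp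
    then show ?thesis by (simp add: D.diff \<psi>.diff d.diff)
  qed
  ultimately have "partial_fold_map (Suc n) \<psi>" using hom by (simp add: partial_fold_map_def)
  then show ?thesis using \<psi>_eq by blast
qed

text \<open>The partial maps stabilise on every step of the filtration, so they glue even if
  infinitely many \<open>F i\<close> are nonzero. The result differs from the identity by a map that
  lowers the filtration, which gives bijectivity by induction.\<close>

lemma isomorphic_fold:
  assumes A0: "\<And>x i. x \<in> F i \<Longrightarrow> component F 0 (d x) \<in> \<delta> 1 ` F 1"
  shows "isomorphic_differential_modules scale d scale D"
proof -
  have "\<exists>\<phi>. \<forall>n. partial_fold_map n (\<phi> n) \<and> (\<forall>x\<in>below n. \<phi> (Suc n) x = \<phi> n x)"
  proof (rule dependent_nat_choice)
    have "partial_fold_map 0 (\<lambda>x. x)"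
      by (auto simp: partial_fold_map_def below_0 D.zero d.zero intro: module_hom_ident subspace_0 subspace_below)
    then show "\<exists>\<phi>. partial_fold_map 0 \<phi>" by (intro exI)
    show "\<exists>\<psi>. partial_fold_map (Suc n) \<psi> \<and> (\<forall>x\<in>below n. \<psi> x = \<phi> x)"
      if "partial_fold_map n \<phi>" for n \<phi>
      by (rule partial_fold_map_step) (fact A0, fact that)
  qed
  then obtain \<phi> where \<phi>: "\<And>n. partial_fold_map n (\<phi> n)" "\<And>n x. x \<in> below n \<Longrightarrow> \<phi> (Suc n) x = \<phi> n x"
    by blast
  have \<phi>_le: "\<phi> n x = \<phi> m x" if "m \<le> n" "x \<in> below m" for m n x
    using that(1)
  proof (induction n rule: dec_induct)
    case (step n)
    then show ?case using \<phi>(2)[OF below_mono[OF _ that(2)]] by simp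
  qed simp
  define \<Phi> where "\<Phi> x = \<phi> (LEAST n. x \<in> below n) x" for x
  have \<Phi>: "\<Phi> x = \<phi> n x" if "x \<in> below n" for x n
    unfolding \<Phi>_def by (rule \<phi>_le[OF Least_le[of "\<lambda>n. x \<in> below n", OF that]
        LeastI[of "\<lambda>n. x \<in> below n", OF that], symmetric])
  have common: "\<exists>n. x \<in> below n \<and> y \<in> below n" for x y
  proof -
    obtain m n where "x \<in> below m" "y \<in> below n" using ex_below by metis
    then show ?thesis using below_mono[of m "max m n"] below_mono[of n "max m n"] by auto
  qed
  have \<phi>_hom: "module_hom scale scale (\<phi> n)" for n using \<phi>(1) by (simp add: partial_fold_map_def)
  have hom: "module_hom scale scale \<Phi>"
  proof
    show "\<Phi> (x + y) = \<Phi> x + \<Phi> y" for x y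
    proof -
      obtain n where n: "x \<in> below n" "y \<in> below n" using common by blast
      then show ?thesis
        using \<Phi>[OF subspace_add[OF subspace_below n]] \<Phi>[of _ n] module_hom.add[OF \<phi>_hom] by simp
    qed
    show "\<Phi> (scale r x) = scale r (\<Phi> x)" for r x
    proof -
      obtain n where n: "x \<in> below n" using ex_below by blast
      then show ?thesis
        using \<Phi>[OF subspace_scale[OF subspace_below n]] \<Phi>[of _ n] module_hom.scale[OF \<phi>_hom] by simp
    qed
  qed
  interpret \<Phi>: module_hom scale scale \<Phi> by (fact hom)
  have comm: "\<Phi> (d x) = D (\<Phi> x)" for x
  proof -
    obtain n where n: "x \<in> below n" using ex_below by blast
    then show ?thesis
      using \<Phi>[OF n] \<Phi>[OF d_below'[OF n]] \<phi>(1)[of n] by (simp add: partial_fold_map_def)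
  qed
  have tri: "\<Phi> x - x \<in> below n" if "x \<in> below (Suc n)" for x n
    using partial_fold_map_triangular(1)[OF \<phi>(1) that] \<Phi>[OF that] by simp
  have inj: "x = 0" if "x \<in> below n" "\<Phi> x = 0" for x n
    using that
  proof (induction n)
    case 0
    then show ?case by (simp add: below_0)
  next
    case (Suc n)
    then have "component F n x = 0" using tri[of x n] by (auto simp: below_def component.neg)
    then show ?case using Suc below_if_top_eq_0 by blast
  qed
  have surj: "\<exists>x. \<Phi> x = y" if "y \<in> below n" for y n
    using that
  proof (induction n arbitrary: y)
    case 0
    then show ?case using \<Phi>.zero below_0[of y] by (intro exI[of _ 0]) simp
  next
    case (Suc n)
    have "y - \<Phi> y \<in> below n"
      using subspace_neg[OF subspace_below tri[OF Suc.prems]] by simp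
    then obtain x where "\<Phi> x = y - \<Phi> y" using Suc.IH by blast
    then have "\<Phi> (x + y) = y" by (simp add: \<Phi>.add)
    then show ?case ..
  qed
  have "bij \<Phi>"
  proof (rule bijI)
    show "inj \<Phi>" using inj ex_below \<Phi>.inj_iff_eq_0 by metis
    show "surj \<Phi>" using surj ex_below by (metis surjI)
  qed
  then show ?thesis unfolding isomorphic_differential_modules_def using hom comm by blast
qed

end

section \<open>The criterion\<close>

locale complete_intersection_flag =
  anchored_flag scale F \<delta> d + complete_intersection_resolution scale F \<delta> \<mm> xs \<epsilon> x0
  for scale :: "'r::comm_ring_1 \<Rightarrow> 'm::ab_group_add \<Rightarrow> 'm" and F \<delta> d \<mm> xs \<epsilon> x0
begin

text \<open>\<open>\<psi>\<close> lifts the functional to R/\<aa>. Although \<open>\<phi>\<close>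
  may spread \<open>y\<close> over all degrees, \<open>\<phi> y\<close> is a cycle of the fold
  because \<open>y\<close> lies in \<open>F 0\<close>. Exactness deals with all its components
  except the one in degree 0, which is what \<open>\<psi>\<close> measures. So
  \<open>\<phi> y\<close> is a boundary, and bijectivity brings this back to
  \<open>y\<close>.\<close>

lemma boundary_if_higher_components:
  assumes \<phi>: "module_hom scale scale \<phi>" "bij \<phi>" "\<And>x. \<phi> (d x) = D (\<phi> x)"
    and higher: "\<And>k. component F (Suc k) (d x) \<in> ideal_times scale \<aa> (F (Suc k))"
  shows "component F 0 (d x) \<in> \<delta> 1 ` F 1"
proof -
  interpret \<phi>: module_hom scale scale \<phi> by (fact \<phi>(1))
  define \<psi> where "\<psi> y = \<epsilon> (component F 0 (\<phi> y))" for y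
  define y where "y = component F 0 (d x)"
  have lin: "linear_between scale UNIV times UNIV \<psi>"
    unfolding \<psi>_def
    by (rule linear_between_compose[OF linear_between_if_module_hom \<epsilon>_linear])
      (use module_hom_compose[OF \<phi>(1) module_hom_component] component_mem in \<open>auto simp: o_def\<close>)
  have boundary: "\<psi> (d x) \<in> \<aa>"
  proof -
    have "component F 0 (\<phi> (d x)) \<in> \<delta> 1 ` F 1"
      using component_mem[of "Suc 0" "\<phi> x"] by (auto simp: \<phi>(3) component_fold)
    then show ?thesis unfolding \<psi>_def using \<epsilon>_kernel component_mem by blast
  qed
  obtain n where "d x \<in> below n" using ex_below by blast
  then have n: "d x \<in> below (Suc n)" by (rule below_mono[rotated]) simp
  have "\<psi> (component F (Suc k) (d x)) \<in> \<aa>" for k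
  proof -
    have "\<psi> (component F (Suc k) (d x)) \<in> ideal_times times \<aa> UNIV"
      by (rule to_ring.linear_between_image_ideal_times[OF lin subspace_UNIV _ _ higher]) auto
    moreover have "ideal_times times \<aa> UNIV \<subseteq> \<aa>"
      by (rule ideal.ideal_times_le[OF ideal.subspace_span]) (metis ideal.span_scale mult.commute)
    ultimately show ?thesis by blast
  qed
  moreover have "\<psi> (d x) = \<psi> y + (\<Sum>k<n. \<psi> (component F (Suc k) (d x)))"
  proof -
    have "d x = (\<Sum>i<Suc n. component F i (d x))" by (rule sum_components_below[OF n])
    also have "\<psi> \<dots> = (\<Sum>i<Suc n. \<psi> (component F i (d x)))"
      by (rule to_ring.linear_between_sum[OF lin subspace_UNIV]) auto
    finally show ?thesis by (simp add: y_def sum.lessThan_Suc_shift del: sum.lessThan_Suc)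
  qed
  ultimately have "\<psi> y \<in> \<aa>"
    using boundary ideal.span_diff[OF boundary ideal.span_sum[of "{..<n}" "\<lambda>k. \<psi> (component F (Suc k) (d x))"]]
    by simp
  then have "component F 0 (\<phi> y) \<in> \<delta> 1 ` F 1" using \<epsilon>_kernel component_mem by (simp add: \<psi>_def)
  moreover have y: "y \<in> F 0" by (simp add: y_def component_mem)
  then have "D (\<phi> y) = 0" using \<phi>(3)[of y] d_0 by (simp add: \<phi>.zero)
  ultimately obtain z where "D z = \<phi> y" using fold_cycle_is_boundary ex_below by blast
  moreover obtain z' where "z = \<phi> z'" using \<phi>(2) by (metis bij_pointE)
  ultimately have "\<phi> (d z') = \<phi> y" using \<phi>(3) by simp
  then have "d z' = y" using \<phi>(2) by (simp add: bij_def inj_eq)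
  then show ?thesis using d_in_summand_0[of z'] y by (simp add: y_def)
qed

text \<open>The induction on \<open>i\<close> provides the maps \<open>A_{k,j'}\<close> with
  \<open>k < i\<close>; within one \<open>i\<close>, \<open>j\<close> descends, so that
  \<open>j = 0\<close> comes last, when all higher components of d x are settled.\<close>

lemma structure_maps_in_ideal:
  assumes \<phi>: "module_hom scale scale \<phi>" "bij \<phi>" "\<And>x. \<phi> (d x) = D (\<phi> x)"
    and "x \<in> F i"
  shows "component F j (d x) \<in> ideal_times scale \<aa> (F j)"
  using assms(4)
proof (induction i arbitrary: x j rule: less_induct)
  case (less i)
  note IH = less.IH and x_mem = less.prems
  have x: "d x \<in> below i" by (rule d_flag[OF x_mem])
  show ?case
  proof (induction "i - j" arbitrary: j rule: less_induct)
    case (less j)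
    consider "i \<le> j" | "i = Suc j" | "j = 0" "Suc j < i" | j' where "j = Suc j'" "Suc j < i"
      by (metis not_less_eq linorder_neqE_nat not_le old.nat.exhaust less_antisym)
    then show ?case
    proof cases
      case 1
      then show ?thesis using x by (simp add: below_def subspace_0)
    next
      case 2
      then show ?thesis using anchored differential_mem_ideal_times x_mem by simp
    next
      case 3
      have "component F (Suc k) (d x) \<in> ideal_times scale \<aa> (F (Suc k))" for k
        using less[of "Suc k"] 3 by simp
      then obtain w where "w \<in> F (Suc 0)" "component F 0 (d x) = \<delta> (Suc 0) w"
        using boundary_if_higher_components[OF \<phi>] by auto
      then show ?thesis using differential_mem_ideal_times 3 by simp
    next
      case 4
      \<comment> \<open>\<open>c k\<close> is the contribution of degree \<open>k\<close> to the
        component of \<open>d (d x)\<close> in \<open>F j'\<close>. It vanishes for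
        \<open>k < j\<close> by the flag condition and is \<open>\<delta> j\<close> of the wanted
        component for \<open>k = j\<close>. For \<open>k > j\<close> it gains one factor \<aa> from
        each of the two inductions.\<close>
      define c where "c k = component F j' (d (component F k (d x)))" for k
      have c_small: "c k = 0" if "k < j" for k
        using d_flag[OF component_mem[of k "d x"]] that 4 by (auto simp: c_def below_def)
      have c_j: "c j = \<delta> j (component F j (d x))"
        using anchored component_mem 4 by (simp add: c_def)
      have c_large: "c k \<in> ideal_times scale \<aa> (ideal_times scale \<aa> (F j'))" if k: "j < k" "k < i" for k
        unfolding c_def
      proof (rule pair.linear_between_image_ideal_times[where A = "F k" and X = "F k"
            and f = "\<lambda>y. component F j' (d y)" and B = UNIV])
        show "linear_between scale (F k) scale UNIV (\<lambda>y. component F j' (d y))"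
          using linear_between_if_module_hom[OF module_hom_compose[OF d_hom module_hom_component]]
          by (simp add: o_def)
        show "component F k (d x) \<in> ideal_times scale \<aa> (F k)" using less k by simp
        show "component F j' (d y) \<in> ideal_times scale \<aa> (F j')" if "y \<in> F k" for y
          using IH[OF k(2) that] .
      qed (auto simp: summand)
      have "d x = (\<Sum>k<i. component F k (d x))" by (rule sum_components_below[OF x])
      then have "d (d x) = (\<Sum>k<i. d (component F k (d x)))" by (metis d.sum)
      then have "0 = component F j' (\<Sum>k<i. d (component F k (d x)))" by simp
      also have "\<dots> = (\<Sum>k<i. c k)" by (simp add: component.sum c_def)
      also have "\<dots> = (\<Sum>k\<in>{j..<i}. c k)"
        using c_small by (intro sum.mono_neutral_right) auto
      also have "\<dots> = c j + (\<Sum>k\<in>{Suc j..<i}. c k)" using 4 by (intro sum.atLeast_Suc_lessThan) auto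
      finally have "\<delta> j (component F j (d x)) = - (\<Sum>k\<in>{Suc j..<i}. c k)"
        using c_j by (metis eq_neg_iff_add_eq_0)
      also have "\<dots> \<in> ideal_times scale \<aa> (ideal_times scale \<aa> (F j'))"
        using c_large by (intro subspace_neg subspace_sum) auto
      finally show ?thesis
        using differential_reflects_ideal_times[OF component_mem] 4 by simp
    qed
  qed
qed

lemma isomorphic_fold_iff:
  "isomorphic_differential_modules scale d scale D \<longleftrightarrow>
     (\<forall>i\<ge>2. \<forall>x\<in>F i. component F 0 (d x) \<in> \<delta> 1 ` F 1)"
proof
  assume "isomorphic_differential_modules scale d scale D"
  then obtain \<phi> where "module_hom scale scale \<phi>" "bij \<phi>" "\<And>x. \<phi> (d x) = D (\<phi> x)"
    unfolding isomorphic_differential_modules_def by blast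
  then show "\<forall>i\<ge>2. \<forall>x\<in>F i. component F 0 (d x) \<in> \<delta> 1 ` F 1"
    using boundary_if_higher_components structure_maps_in_ideal by blast
next
  assume A: "\<forall>i\<ge>2. \<forall>x\<in>F i. component F 0 (d x) \<in> \<delta> 1 ` F 1"
  show "isomorphic_differential_modules scale d scale D"
  proof (rule isomorphic_fold)
    fix x i assume x: "x \<in> F i"
    \<comment> \<open>The criterion starts at 2, while the construction asks for all
      \<open>i\<close>; for \<open>i = 1\<close> anchoring makes the structure map equal to
      \<open>\<delta> 1\<close>.\<close>
    consider "i = 0" | "i = Suc 0" | "i \<ge> 2" by linarith
    then show "component F 0 (d x) \<in> \<delta> 1 ` F 1"
    proof cases
      case 1
      then show ?thesis using d_0 x subspace_0[OF subspace_boundaries[of 0]] by simp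
    next
      case 2
      then show ?thesis using anchored x by simp
    qed (use A x in blast)
  qed
qed

end

section \<open>Cosets and the augmentation\<close>

lemma (in Modules.module) coset_eq_iff:
  assumes A: "subspace A"
  shows "x +o A = y +o A \<longleftrightarrow> x - y \<in> A"
proof
  assume "x +o A = y +o A"
  moreover have "x \<in> x +o A" using subspace_0[OF A] by (force simp: elt_set_plus_def)
  ultimately obtain a where "a \<in> A" "x = y + a" by (auto simp: elt_set_plus_def)
  then show "x - y \<in> A" by simp
next
  assume xy: "x - y \<in> A"
  show "x +o A = y +o A"
  proof (intro equalityI subsetI)
    fix z assume "z \<in> x +o A"
    then obtain a where a: "a \<in> A" "z = x + a" by (auto simp: elt_set_plus_def)
    then have "z = y + ((x - y) + a)" by simp
    then show "z \<in> y +o A" using subspace_add[OF A xy a(1)] unfolding elt_set_plus_def by blast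
  next
    fix z assume "z \<in> y +o A"
    then obtain a where a: "a \<in> A" "z = y + a" by (auto simp: elt_set_plus_def)
    then have "z = x + (a - (x - y))" by simp
    then show "z \<in> x +o A" using subspace_diff[OF A a(1) xy] unfolding elt_set_plus_def by blast
  qed
qed

lemma (in Modules.module) subspace_plus_self: "subspace A \<Longrightarrow> A + A = A"
  by (auto simp: set_plus_def intro: subspace_add) (metis add_0 subspace_0)

lemma (in Modules.module) coset_plus:
  "subspace A \<Longrightarrow> (x +o A) + (y +o A) = (x + y) +o A"
  by (simp add: set_plus_rearrange subspace_plus_self)

lemma (in Modules.module) quotient_scale_coset:
  assumes A: "subspace A"
  shows "quotient_scale scale A r (x +o A) = scale r x +o A"
proof -
  have "scale r ` (x +o A) = scale r x +o scale r ` A"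
    by (force simp: elt_set_plus_def scale_right_distrib image_iff)
  moreover have "scale r ` A + A = A"
  proof
    show "scale r ` A + A \<subseteq> A"
      using A by (auto simp: set_plus_def intro: subspace_add subspace_scale)
    show "A \<subseteq> scale r ` A + A"
      using subspace_0[OF A] scale_zero_right[of r] by (force simp: set_plus_def)
  qed
  ultimately show ?thesis by (simp add: quotient_scale_def set_plus_rearrange3)
qed

text \<open>
  The type of cosets is not a module, so a map to a cyclic module is not literally an instance of
  lifting along a surjection.
\<close>

lemma lift_to_ring:
  assumes s: "Modules.module s" and N: "free_submodule s N" and A: "ideal.subspace A"
    and \<theta>: "linear_between s N (quotient_scale times A) (quotient_module UNIV A) \<theta>"
  shows "\<exists>\<epsilon>. linear_between s N times UNIV \<epsilon> \<and> (\<forall>x\<in>N. \<theta> x = \<epsilon> x +o A)"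
proof -
  interpret Modules.module s by fact
  obtain B where B: "free_basis s N B (\<lambda>b. b) (representation B)"
    using free_basis_if_free_submodule[OF s N] by blast
  interpret free_basis s N B "\<lambda>b. b" "representation B" by fact
  have "\<exists>r. \<theta> x = r +o A" if "x \<in> N" for x
    using linear_between_mem[OF \<theta> that] by (auto simp: quotient_module_def)
  then obtain c where c: "\<And>x. x \<in> N \<Longrightarrow> \<theta> x = c x +o A" by metis
  obtain \<epsilon> where \<epsilon>: "linear_between s N times UNIV \<epsilon>" "\<forall>b\<in>B. \<epsilon> b = c b"
    using linear_extension[OF ideal.module_axioms ideal.subspace_UNIV, of c] by auto
  have T: "subspace {x \<in> N. \<theta> x = \<epsilon> x +o A}"
  proof (rule subspaceI)
    have "\<theta> (s 0 0) = (0 * c 0) +o A"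
      unfolding linear_between_scale[OF \<theta> subspace_0[OF subspace]] c[OF subspace_0[OF subspace]]
      by (rule ideal.quotient_scale_coset[OF A])
    then show "0 \<in> {x \<in> N. \<theta> x = \<epsilon> x +o A}"
      using subspace_0[OF subspace] to_ring.linear_between_zero[OF \<epsilon>(1) subspace] by simp
    show "x + y \<in> {x \<in> N. \<theta> x = \<epsilon> x +o A}"
      if "x \<in> {x \<in> N. \<theta> x = \<epsilon> x +o A}" "y \<in> {x \<in> N. \<theta> x = \<epsilon> x +o A}" for x y
      using that linear_between_add[OF \<theta>] linear_between_add[OF \<epsilon>(1)]
      by (simp add: ideal.coset_plus[OF A] subspace_add[OF subspace])
    show "s r x \<in> {x \<in> N. \<theta> x = \<epsilon> x +o A}" if "x \<in> {x \<in> N. \<theta> x = \<epsilon> x +o A}" for r x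
      using that linear_between_scale[OF \<theta>] linear_between_scale[OF \<epsilon>(1)]
      by (simp add: ideal.quotient_scale_coset[OF A] subspace_scale[OF subspace])
  qed
  have "x \<in> {x \<in> N. \<theta> x = \<epsilon> x +o A}" if "x \<in> N" for x
  proof -
    have "(\<Sum>b | b \<in> B \<and> representation B x b \<noteq> 0. s (representation B x b) b) \<in> {x \<in> N. \<theta> x = \<epsilon> x +o A}"
      using \<epsilon>(2) c e_mem by (intro subspace_sum[OF T] subspace_scale[OF T]) auto
    then show ?thesis using expansion[OF that] by simp
  qed
  then show ?thesis using \<epsilon>(1) by blast
qed

lemma graded_local_ring_proper:
  assumes "graded_local_ring \<mm>"
  shows "ideal.subspace \<mm>" "1 \<notin> \<mm>"
proof -
  have *: "ideal.subspace \<mm> \<and> \<mm> \<noteq> UNIV"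
    using assms unfolding graded_local_ring_def maximal_members_def proper_ideals_def by blast
  then show "ideal.subspace \<mm>" ..
  show "1 \<notin> \<mm>"
  proof
    assume "1 \<in> \<mm>"
    then have "r \<in> \<mm>" for r using ideal.subspace_scale[of \<mm> 1 r] * by simp
    then show False using * by blast
  qed
qed

theorem theorem1p5:
  fixes \<mm> :: "'r::comm_ring_1 set"
    and scale :: "'r \<Rightarrow> 'm::ab_group_add \<Rightarrow> 'm"
    and d :: "'m \<Rightarrow> 'm"
    and F :: "nat \<Rightarrow> 'm set"
    and \<delta> :: "nat \<Rightarrow> 'm \<Rightarrow> 'm"
  assumes "graded_local_ring \<mm>"
    and "anchored_free_flag \<mm> scale d F \<delta>"
    and "homology_complete_intersection scale d"
  shows "isomorphic_differential_modules scale d scale (fold_differential F \<delta>) \<longleftrightarrow>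
         (\<forall>i\<ge>2. structure_map F d i 0 ` F i \<subseteq> \<delta> 1 ` F 1)"
proof -
  have flag: "free_flag scale d F"
    and res: "minimal_free_resolution_of_homology \<mm> scale d F \<delta>"
    and anchored: "\<And>i x. i \<ge> 1 \<Longrightarrow> x \<in> F i \<Longrightarrow> component F (i - 1) (d x) = \<delta> i x"
    using assms(2) by (auto simp: anchored_free_flag_def structure_map_def)
  have d_hom: "module_hom scale scale d" and d_d: "\<And>x. d (d x) = 0"
    and direct: "internal_direct_sum F" and free: "\<And>i. free_submodule scale (F i)"
    and d_span: "\<And>i. d ` F i \<subseteq> Modules.module.span scale (\<Union>j<i. F j)"
    using flag by (auto simp: free_flag_def differential_module_def)
  interpret Modules.module scale using d_hom by (simp add: module_hom_def)
  interpret module_direct_sum scale F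
    using direct free subspace_span by unfold_locales (simp, metis free_submodule_def)
  interpret acyclic_free_complex scale F \<delta>
  proof
    fix i
    show "free_submodule scale (F i)" by (fact free)
    show "linear_between scale (F (Suc i)) scale (F i) (\<delta> (Suc i))"
      using res unfolding minimal_free_resolution_of_homology_def
      by (metis diff_Suc_1 le_add1 plus_1_eq_Suc)
    show "{x \<in> F (Suc i). \<delta> (Suc i) x = 0} = \<delta> (Suc (Suc i)) ` F (Suc (Suc i))"
      using res unfolding minimal_free_resolution_of_homology_def
      by (metis Suc_eq_plus1 le_add1 plus_1_eq_Suc)
  qed
  interpret anchored_flag scale F \<delta> d
  proof (intro anchored_flag.intro anchored_flag_axioms.intro)
    show "d x \<in> below i" if "x \<in> F i" for x i
      using d_span[of i] span_summands_subset_below[of i] that by blast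
    show "component F i (d x) = \<delta> (Suc i) x" if "x \<in> F (Suc i)" for x i
      using anchored[of "Suc i" x] that by simp
  qed (fact module_direct_sum_axioms acyclic_free_complex_axioms d_hom d_d)+
  obtain \<epsilon>' where \<epsilon>': "linear_between scale (F 0) (homology_scale scale d) (homology d) \<epsilon>'"
    "\<epsilon>' ` F 0 = homology d" "{x \<in> F 0. \<epsilon>' x = range d} = \<delta> 1 ` F 1"
    using res unfolding minimal_free_resolution_of_homology_def by (elim conjE exE) (rule that)
  obtain xs f where regular: "regular_sequence xs"
    and f: "linear_between (homology_scale scale d) (homology d)
      (quotient_scale times (ideal.span (set xs))) (quotient_module UNIV (ideal.span (set xs))) f"
      "bij_betw f (homology d) (quotient_module UNIV (ideal.span (set xs)))"
    using assms(3) unfolding homology_complete_intersection_def by blast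
  define \<aa> where "\<aa> = ideal.span (set xs)"
  have \<aa>: "ideal.subspace \<aa>" by (simp add: \<aa>_def)
  note f = f[folded \<aa>_def]
  obtain \<epsilon> where \<epsilon>: "linear_between scale (F 0) times UNIV \<epsilon>" "\<And>x. x \<in> F 0 \<Longrightarrow> f (\<epsilon>' x) = \<epsilon> x +o \<aa>"
    using lift_to_ring[OF module_axioms free \<aa> linear_between_compose[OF \<epsilon>'(1) f(1)]] by blast
  have range_d: "subspace (range d)" by (rule d.subspace_image) simp
  have zero: "range d \<in> homology d"
    unfolding homology_def quotient_module_def mem_Collect_eq
    by (rule exI[of _ 0]) (simp add: d.zero)
  \<comment> \<open>Cosets do not form a group type, so \<open>f\<close> is not known to preserve
    zero; multiplying by the scalar 0 shows it.\<close>
  have "f (homology_scale scale d 0 (range d)) = quotient_scale times \<aa> 0 (f (range d))"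
    by (rule linear_between_scale[OF f(1) zero])
  moreover have "homology_scale scale d 0 (range d) = range d"
    using quotient_scale_coset[OF range_d, of 0 0] by (simp add: homology_scale_def)
  moreover obtain c where "f (range d) = c +o \<aa>"
    using linear_between_mem[OF f(1) zero] by (auto simp: quotient_module_def)
  ultimately have f_zero: "f (range d) = 0 +o \<aa>"
    using ideal.quotient_scale_coset[OF \<aa>, of 0 c] by simp
  have kernel: "\<epsilon> x \<in> \<aa> \<longleftrightarrow> x \<in> \<delta> 1 ` F 1" if x: "x \<in> F 0" for x
  proof -
    have "\<epsilon> x \<in> \<aa> \<longleftrightarrow> f (\<epsilon>' x) = f (range d)"
      using ideal.coset_eq_iff[OF \<aa>, of "\<epsilon> x" 0] by (simp add: \<epsilon>(2)[OF x] f_zero)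
    also have "\<dots> \<longleftrightarrow> \<epsilon>' x = range d"
      using f(2) zero linear_between_mem[OF \<epsilon>'(1) x] by (auto simp: bij_betw_def dest: inj_onD)
    also have "\<dots> \<longleftrightarrow> x \<in> \<delta> 1 ` F 1" using \<epsilon>'(3) x by blast
    finally show ?thesis .
  qed
  have "1 +o \<aa> \<in> f ` \<epsilon>' ` F 0"
    using f(2) \<epsilon>'(2) by (auto simp: bij_betw_def quotient_module_def)
  then obtain x0 where x0: "x0 \<in> F 0" "\<epsilon> x0 +o \<aa> = 1 +o \<aa>" using \<epsilon>(2) by auto
  \<comment> \<open>The Koszul recursion needs each entry to be regular modulo those after it, so
    the sequence is reversed; the generated ideal stays the same.\<close>
  interpret complete_intersection_flag scale F \<delta> d \<mm> "rev xs" \<epsilon> x0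
  proof unfold_locales
    show "ideal.subspace \<mm>" "1 \<notin> \<mm>" using graded_local_ring_proper[OF assms(1)] .
    show "\<delta> (Suc i) x \<in> ideal_times scale \<mm> (F i)" if "x \<in> F (Suc i)" for x i
    proof -
      have "\<forall>i\<ge>1. \<delta> i ` F i \<subseteq> span {scale a x | a x. a \<in> \<mm> \<and> x \<in> F (i - 1)}"
        using res unfolding minimal_free_resolution_of_homology_def by (elim conjE)
      from this[rule_format, of "Suc i"] show ?thesis
        unfolding ideal_times_def using that by auto
    qed
    show "regular_rev (rev xs)"
      using regular by (intro regular_rev_rev) (auto simp: regular_sequence_def)
    show "linear_between scale (F 0) times UNIV \<epsilon>" by (fact \<epsilon>(1))
    show "\<epsilon> x \<in> ideal.span (set (rev xs)) \<longleftrightarrow> x \<in> \<delta> 1 ` F 1" if "x \<in> F 0" for x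
      using kernel[OF that] by (simp add: \<aa>_def)
    show "x0 \<in> F 0" by (fact x0(1))
    show "\<epsilon> x0 - 1 \<in> ideal.span (set (rev xs))"
      using x0(2) ideal.coset_eq_iff[OF \<aa>, of "\<epsilon> x0" 1] by (simp add: \<aa>_def)
  qed
  show ?thesis
    using isomorphic_fold_iff by (simp add: structure_map_def image_subset_iff)
qed

end
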